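(* Let $\Sigma$ be a centered cyclic Lagrangian surface of $\mathbb{C}^2$, i.e. a Lagrangian surface foliated by round circles all of which have their center at the origin. Then, up to $U(2)$ congruence, $\Sigma$ may be locally parametrized by one of the following immersions $X : I\times \mathbb{R}/2\pi\mathbb{Z}\to\mathbb{C}^2$ ($I\subset\mathbb{R}$ an interval): Type I (complex extensors): $X(s,t) = r(s)e^{i\phi(s)}(\cos t,\sin t)$, where $r$ is a positive function and $\phi$ a real-valued function on $I$; Type II (Hopf type): $X(s,t)= c\,e^{it}(\gamma_1(s),\gamma_2(s))$, where $\gamma=(\gamma_1,\gamma_2)$ is any Legendrian curve of $\mathbb{S}^3$ and $c$ is a real constant; Type III (De Sitter type): $X(s,t) = c\,(\alpha_1(s)e^{it},\alpha_2(s)e^{-it})$, where $\alpha=(\alpha_1,\alpha_2)$ is any Legendrian curve in the unit anti-De Sitter space $\mathbb{H}^3_1$ and $c$ is a real constant.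
   Context: $\mathbb{C}^2\simeq\mathbb{R}^4$ carries its standard Euclidean inner product $\langle\cdot,\cdot\rangle$ and complex structure $J$ (multiplication by $i$); on $\mathbb{C}\simeq\mathbb{R}^2$, $\langle\cdot,\cdot\rangle$ also denotes the Euclidean inner product $\langle z,w\rangle=\mathrm{Re}(z\bar w)$. A surface is Lagrangian if $\langle v,Jw\rangle=0$ for all tangent vectors $v,w$ at the same point. A surface is cyclic if it is foliated by round circles. A centered cyclic surface is one for which the centers of all the circles coincide, the common center being located at the origin; locally it is parametrized by an immersion $X(s,t)=r(s)(e_1(s)\cos t+e_2(s)\sin t)$, with $r>0$ and $(e_1(s),e_2(s))$ an orthonormal pair in $\mathbb{R}^4$. A curve $\gamma=(\gamma_1,\gamma_2)$ in the unit sphere $\mathbb{S}^3\subset\mathbb{C}^2$ is Legendrian if $\langle\gamma',J\gamma\rangle=0$; it need not be regular (it may be constant). The unit anti-De Sitter space is $\mathbb{H}^3_1=\{(\alpha_1,\alpha_2)\in\mathbb{C}^2 : |\alpha_1|^2-|\alpha_2|^2=-1\}$; a curve $\alpha=(\alpha_1,\alpha_2)$ in $\mathbb{H}^3_1$ is Legendrian if $\langle\alpha_1',i\alpha_1\rangle-\langle\alpha_2',i\alpha_2\rangle=0$. All objects are smooth. *)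

theory Defs
  imports "HOL-Analysis.Analysis"
begin

text \<open>Both notions are only meaningful for open \<^term>\<open>S\<close>.\<close>

primrec higher_differentiable_on ::
    "'a::real_normed_vector set \<Rightarrow> ('a \<Rightarrow> 'b::real_normed_vector) \<Rightarrow> nat \<Rightarrow> bool" where
  "higher_differentiable_on S f 0 \<longleftrightarrow> continuous_on S f"
| "higher_differentiable_on S f (Suc n) \<longleftrightarrow>
     (\<forall>x\<in>S. f differentiable (at x)) \<and>
     (\<forall>v. higher_differentiable_on S (\<lambda>x. frechet_derivative f (at x) v) n)"

definition smooth_on :: "'a::real_normed_vector set \<Rightarrow> ('a \<Rightarrow> 'b::real_normed_vector) \<Rightarrow> bool" where
  "smooth_on S f \<longleftrightarrow> (\<forall>n. higher_differentiable_on S f n)"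

definition open_interval :: "real set \<Rightarrow> bool" where
  "open_interval I \<longleftrightarrow> open I \<and> is_interval I \<and> I \<noteq> {}"

text \<open>
  The space \<open>\<complex>\<^sup>2\<close> is \<^typ>\<open>complex ^ 2\<close>; its library inner product is the standard Euclidean one of
  \<open>\<real>\<^sup>4\<close>, and the complex structure \<open>J\<close> is scalar multiplication by \<^term>\<open>\<i>\<close>.

  An immersed surface is a topological surface \<open>M\<close> together with a map \<open>F\<close> into \<open>\<complex>\<^sup>2\<close> that is a smooth
  immersion in local parameters.  The smooth structure of \<open>M\<close> need not be given separately: it is
  the one determined by \<open>F\<close>.  A parametrization is only required to be continuous and open; it is
  automatically locally injective, hence a local homeomorphism, because its composition with \<open>F\<close>
  is an immersion.
\<close>

definition immersion_on :: "(real \<times> real) set \<Rightarrow> (real \<times> real \<Rightarrow> complex ^ 2) \<Rightarrow> bool" where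
  "immersion_on \<Omega> X \<longleftrightarrow>
     smooth_on \<Omega> X \<and> (\<forall>x\<in>\<Omega>. inj (frechet_derivative X (at x)))"

definition parametrization ::
    "'m topology \<Rightarrow> ('m \<Rightarrow> complex ^ 2) \<Rightarrow> (real \<times> real) set \<Rightarrow> (real \<times> real \<Rightarrow> 'm) \<Rightarrow> bool" where
  "parametrization M F \<Omega> p \<longleftrightarrow>
     open \<Omega> \<and> continuous_map (top_of_set \<Omega>) M p \<and> open_map (top_of_set \<Omega>) M p \<and>
     immersion_on \<Omega> (F \<circ> p)"

definition immersed_surface :: "'m topology \<Rightarrow> ('m \<Rightarrow> complex ^ 2) \<Rightarrow> bool" where
  "immersed_surface M F \<longleftrightarrow>
     Hausdorff_space M \<and> second_countable M \<and>
     (\<forall>q\<in>topspace M. \<exists>\<Omega> p. parametrization M F \<Omega> p \<and> q \<in> p ` \<Omega>)"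

definition tangent_vectors :: "'m topology \<Rightarrow> ('m \<Rightarrow> complex ^ 2) \<Rightarrow> 'm \<Rightarrow> (complex ^ 2) set" where
  "tangent_vectors M F q =
     {frechet_derivative (F \<circ> p) (at x) h | \<Omega> p x h. parametrization M F \<Omega> p \<and> x \<in> \<Omega> \<and> p x = q}"

definition lagrangian :: "'m topology \<Rightarrow> ('m \<Rightarrow> complex ^ 2) \<Rightarrow> bool" where
  "lagrangian M F \<longleftrightarrow>
     (\<forall>q\<in>topspace M. \<forall>v\<in>tangent_vectors M F q. \<forall>w\<in>tangent_vectors M F q. v \<bullet> (\<i> *s w) = 0)"

text \<open>
  A parametrization over \<open>I \<times> \<real>/2\<pi>\<int>\<close> is encoded as one over \<open>I \<times> \<real>\<close> that identifies exactly
  the points whose second coordinates differ by a multiple of \<open>2\<pi>\<close>.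
\<close>

definition annular_parametrization ::
    "'m topology \<Rightarrow> ('m \<Rightarrow> complex ^ 2) \<Rightarrow> real set \<Rightarrow> (real \<times> real \<Rightarrow> 'm) \<Rightarrow> bool" where
  "annular_parametrization M F I p \<longleftrightarrow>
     open_interval I \<and> parametrization M F (I \<times> UNIV) p \<and>
     (\<forall>s\<in>I. \<forall>s'\<in>I. \<forall>t t'. p (s, t) = p (s', t') \<longleftrightarrow>
        s = s' \<and> (\<exists>k::int. t' = t + 2 * pi * of_int k))"

definition centered_circles :: "real set \<Rightarrow> (real \<Rightarrow> real \<Rightarrow> complex ^ 2) \<Rightarrow> bool" where
  "centered_circles I X \<longleftrightarrow>
     (\<exists>r e1 e2. smooth_on I (r :: real \<Rightarrow> real) \<and> smooth_on I e1 \<and> smooth_on I e2 \<and>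
        (\<forall>s\<in>I. r s > 0 \<and> norm (e1 s) = 1 \<and> norm (e2 s) = 1 \<and> e1 s \<bullet> e2 s = 0) \<and>
        (\<forall>s\<in>I. \<forall>t. X s t = r s *\<^sub>R (cos t *\<^sub>R e1 s + sin t *\<^sub>R e2 s)))"

text \<open>\<open>L\<close> is the set of leaves of the foliation of the surface by circles.\<close>

definition centered_cyclic_surface :: "'m topology \<Rightarrow> ('m \<Rightarrow> complex ^ 2) \<Rightarrow> bool" where
  "centered_cyclic_surface M F \<longleftrightarrow>
     immersed_surface M F \<and>
     (\<exists>L. partition_on (topspace M) L \<and>
        (\<forall>q\<in>topspace M. \<exists>I p.
           annular_parametrization M F I p \<and> q \<in> p ` (I \<times> UNIV) \<and>
           centered_circles I (\<lambda>s t. F (p (s, t))) \<and>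
           (\<forall>s\<in>I. p ` ({s} \<times> UNIV) \<in> L)))"

definition U2 :: "(complex ^ 2 ^ 2) set" where
  "U2 = {A. map_matrix cnj (transpose A) ** A = mat 1}"

definition legendrian_S3 :: "real set \<Rightarrow> (real \<Rightarrow> complex ^ 2) \<Rightarrow> bool" where
  "legendrian_S3 I \<gamma> \<longleftrightarrow>
     smooth_on I \<gamma> \<and>
     (\<forall>s\<in>I. norm (\<gamma> s) = 1 \<and> vector_derivative \<gamma> (at s) \<bullet> (\<i> *s \<gamma> s) = 0)"

definition anti_de_Sitter :: "(complex ^ 2) set" where
  "anti_de_Sitter = {a. (cmod (a $ 1))\<^sup>2 - (cmod (a $ 2))\<^sup>2 = - 1}"

definition legendrian_AdS :: "real set \<Rightarrow> (real \<Rightarrow> complex ^ 2) \<Rightarrow> bool" where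
  "legendrian_AdS I \<alpha> \<longleftrightarrow>
     smooth_on I \<alpha> \<and>
     (\<forall>s\<in>I. \<alpha> s \<in> anti_de_Sitter \<and>
        (vector_derivative \<alpha> (at s) $ 1) \<bullet> (\<i> * \<alpha> s $ 1) -
        (vector_derivative \<alpha> (at s) $ 2) \<bullet> (\<i> * \<alpha> s $ 2) = 0)"

definition complex_extensor :: "real set \<Rightarrow> (real \<Rightarrow> real \<Rightarrow> complex ^ 2) \<Rightarrow> bool" where
  "complex_extensor I X \<longleftrightarrow>
     (\<exists>(r :: real \<Rightarrow> real) (\<phi> :: real \<Rightarrow> real). smooth_on I r \<and> smooth_on I \<phi> \<and> (\<forall>s\<in>I. r s > 0) \<and>
        (\<forall>s\<in>I. \<forall>t. X s t =
           (complex_of_real (r s) * exp (\<i> * complex_of_real (\<phi> s))) *s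
             vector [complex_of_real (cos t), complex_of_real (sin t)]))"

definition hopf_type :: "real set \<Rightarrow> (real \<Rightarrow> real \<Rightarrow> complex ^ 2) \<Rightarrow> bool" where
  "hopf_type I X \<longleftrightarrow>
     (\<exists>(c :: real) \<gamma>. legendrian_S3 I \<gamma> \<and>
        (\<forall>s\<in>I. \<forall>t. X s t =
           (complex_of_real c * exp (\<i> * complex_of_real t)) *s \<gamma> s))"

definition de_Sitter_type :: "real set \<Rightarrow> (real \<Rightarrow> real \<Rightarrow> complex ^ 2) \<Rightarrow> bool" where
  "de_Sitter_type I X \<longleftrightarrow>
     (\<exists>(c :: real) \<alpha>. legendrian_AdS I \<alpha> \<and>
        (\<forall>s\<in>I. \<forall>t. X s t =
           complex_of_real c *s
             vector [\<alpha> s $ 1 * exp (\<i> * complex_of_real t),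
                     \<alpha> s $ 2 * exp (- \<i> * complex_of_real t)]))"

end

theory Submission
  imports Defs
begin

text \<open>A centered circle is \<open>t \<mapsto> e\<^sup>i\<^sup>t u + e\<^sup>-\<^sup>i\<^sup>t v\<close> with \<open>u\<close>, \<open>v\<close> in \<open>\<complex>\<^sup>2\<close>, and its
  points have constant norm exactly when \<open>u\<close> and \<open>v\<close> are Hermitian orthogonal.  So a centered
  cyclic surface is locally a pair of orthogonal curves \<open>u(s)\<close>, \<open>v(s)\<close>
  (lemma \<open>centered_circles_Fourier\<close>).  Expanding \<open>\<langle>X\<^sub>s, J X\<^sub>t\<rangle> = 0\<close> in \<open>t\<close> gives three
  conditions: \<open>\<bar>u\<bar>\<^sup>2 - \<bar>v\<bar>\<^sup>2 = k\<close> is constant, \<open>u' \<bottom> v\<close> and \<open>v' \<bottom> u\<close>.  In complex dimension two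
  the last two say that wherever \<open>v \<noteq> 0\<close> the derivative \<open>u'\<close> is a complex multiple of \<open>u\<close>
  (when \<open>u \<noteq> 0\<close>), and symmetrically for \<open>v\<close>; a nonvanishing curve with this property stays on a fixed
  complex line (lemma \<open>curve_on_complex_line\<close>).

  If \<open>k = 0\<close>, neither curve vanishes, both stay on complex lines and have the same norm, so they
  differ from two fixed orthogonal vectors by phases and a common real factor; half the sum of
  the phases is \<open>\<phi>\<close> and half the difference is absorbed into \<open>t\<close>.  This is type I.

  If \<open>k \<noteq> 0\<close>, reversing the circles makes \<open>k\<close> negative, so \<open>v\<close> does not vanish, but \<open>u\<close>
  may.  A surface could thus conceivably pass from Hopf type (\<open>u = 0\<close>) to De Sitter type at some
  parameter \<open>s\<^sub>0\<close>.  The immersion property excludes this.  If \<open>v\<close> and \<open>v'\<close> are complex independent at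
  \<open>s\<^sub>0\<close>, they are so nearby, and \<open>u\<close>, orthogonal to both, vanishes nearby: type II.  If they are
  dependent at \<open>s\<^sub>0\<close>, then \<open>u(s\<^sub>0)\<close> and \<open>u'(s\<^sub>0)\<close> cannot both vanish, since otherwise \<open>X\<^sub>s\<close> would be
  a multiple of \<open>X\<^sub>t\<close>; so \<open>u \<noteq> 0\<close> at all parameters near \<open>s\<^sub>0\<close> other than possibly \<open>s\<^sub>0\<close>, \<open>v\<close> stays on a complex
  line, and \<open>u\<close> on the orthogonal one: type III.  In both cases a shift \<open>t \<mapsto> t + \<theta>(s)\<close> makes the
  profile curve Legendrian (lemmas \<open>legendrian_S3_phase\<close> and \<open>legendrian_AdS_phase\<close>).\<close>

section \<open>Calculus of smooth maps\<close>

lemma higher_differentiable_on_cong: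
  assumes "open S" "\<And>x. x \<in> S \<Longrightarrow> f x = g x"
  shows "higher_differentiable_on S f n \<longleftrightarrow> higher_differentiable_on S g n"
  using assms(2)
proof (induction n arbitrary: f g)
  case 0
  then show ?case by (simp cong: continuous_on_cong)
next
  case (Suc n)
  have diff: "f differentiable at x \<longleftrightarrow> g differentiable at x" if "x \<in> S" for x
    using Suc.prems has_derivative_transform_within_open[OF _ assms(1) that, of f _ UNIV g]
      has_derivative_transform_within_open[OF _ assms(1) that, of g _ UNIV f]
    unfolding differentiable_def by metis
  have "frechet_derivative f (at x) = frechet_derivative g (at x)"
    if "x \<in> S" "f differentiable at x" for x
    by (rule frechet_derivative_transform_within_open[OF that(2) assms(1) that(1)]) (rule Suc.prems)
  then have "higher_differentiable_on S (\<lambda>x. frechet_derivative f (at x) v) n \<longleftrightarrow>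
      higher_differentiable_on S (\<lambda>x. frechet_derivative g (at x) v) n"
    if "\<forall>x\<in>S. f differentiable at x" for v
    using that by (intro Suc.IH) auto
  then show ?case using diff by auto
qed

lemma higher_differentiable_on_SucI:
  assumes "open S" "\<And>x. x \<in> S \<Longrightarrow> (f has_derivative f' x) (at x)"
    and "\<And>v. higher_differentiable_on S (\<lambda>x. f' x v) n"
  shows "higher_differentiable_on S f (Suc n)"
proof -
  have "frechet_derivative f (at x) = f' x" if "x \<in> S" for x
    using frechet_derivative_at[OF assms(2)[OF that]] by simp
  then have "higher_differentiable_on S (\<lambda>x. frechet_derivative f (at x) v) n" for v
    by (intro iffD2[OF higher_differentiable_on_cong[OF assms(1)] assms(3)]) simp
  then show ?thesis using assms(2) by (auto simp: differentiable_def)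
qed

lemma higher_differentiable_on_has_derivative:
  assumes "higher_differentiable_on S f (Suc n)" "x \<in> S"
  shows "(f has_derivative frechet_derivative f (at x)) (at x)"
  using assms frechet_derivative_works by auto

lemma higher_differentiable_on_SucD:
  "higher_differentiable_on S f (Suc n) \<Longrightarrow> higher_differentiable_on S f n"
proof (induction n arbitrary: f)
  case 0
  then show ?case
    by (auto intro!: continuous_at_imp_continuous_on differentiable_imp_continuous_within)
next
  case (Suc n)
  have "higher_differentiable_on S (\<lambda>x. frechet_derivative f (at x) v) n" for v
    using Suc.prems by (intro Suc.IH) (subst (asm) higher_differentiable_on.simps(2), blast)
  moreover have "\<forall>x\<in>S. f differentiable at x"
    using Suc.prems by (subst (asm) higher_differentiable_on.simps(2)) blast
  ultimately show ?case by simp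
qed

lemma higher_differentiable_on_subset:
  "higher_differentiable_on S f n \<Longrightarrow> T \<subseteq> S \<Longrightarrow> higher_differentiable_on T f n"
  by (induction n arbitrary: f) (auto intro: continuous_on_subset)

lemma higher_differentiable_on_const: "open S \<Longrightarrow> higher_differentiable_on S (\<lambda>x. c) n"
proof (induction n arbitrary: c)
  case (Suc n)
  show ?case
    by (rule higher_differentiable_on_SucI[where f' = "\<lambda>_ _. 0"]) (use Suc in simp_all)
qed simp

lemma higher_differentiable_on_add:
  assumes "open S" "higher_differentiable_on S f n" "higher_differentiable_on S g n"
  shows "higher_differentiable_on S (\<lambda>x. f x + g x) n"
  using assms(2,3)
proof (induction n arbitrary: f g)
  case 0
  then show ?case by (auto intro: continuous_on_add)
next
  case (Suc n)
  show ?case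
  proof (rule higher_differentiable_on_SucI[OF assms(1)])
    show "((\<lambda>x. f x + g x) has_derivative
        (\<lambda>v. frechet_derivative f (at x) v + frechet_derivative g (at x) v)) (at x)"
      if "x \<in> S" for x
      using Suc.prems[THEN higher_differentiable_on_has_derivative, OF that] by (rule has_derivative_add)
    show "higher_differentiable_on S
        (\<lambda>x. frechet_derivative f (at x) v + frechet_derivative g (at x) v) n" for v
      using Suc.prems by (intro Suc.IH) auto
  qed
qed

lemma higher_differentiable_on_bilinear:
  assumes "open S" "bounded_bilinear B" "higher_differentiable_on S f n" "higher_differentiable_on S g n"
  shows "higher_differentiable_on S (\<lambda>x. B (f x) (g x)) n"
  using assms(3,4)
proof (induction n arbitrary: f g)
  case 0
  then show ?case using bounded_bilinear.continuous_on[OF assms(2)] by simp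
next
  case (Suc n)
  show ?case
  proof (rule higher_differentiable_on_SucI[OF assms(1)])
    show "((\<lambda>x. B (f x) (g x)) has_derivative
        (\<lambda>v. B (f x) (frechet_derivative g (at x) v) + B (frechet_derivative f (at x) v) (g x))) (at x)"
      if "x \<in> S" for x
      using Suc.prems[THEN higher_differentiable_on_has_derivative, OF that]
      by (rule bounded_bilinear.FDERIV[OF assms(2)])
    show "higher_differentiable_on S (\<lambda>x. B (f x) (frechet_derivative g (at x) v)
        + B (frechet_derivative f (at x) v) (g x)) n" for v
      using Suc.prems higher_differentiable_on_SucD[OF Suc.prems(1)] higher_differentiable_on_SucD[OF Suc.prems(2)]
      by (intro higher_differentiable_on_add[OF assms(1)] Suc.IH) auto
  qed
qed

lemma higher_differentiable_on_linear:
  assumes "open S" "bounded_linear L" "higher_differentiable_on S f n"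
  shows "higher_differentiable_on S (\<lambda>x. L (f x)) n"
  using assms(3)
proof (induction n arbitrary: f)
  case 0
  then show ?case using bounded_linear.continuous_on[OF assms(2)] by simp
next
  case (Suc n)
  show ?case
  proof (rule higher_differentiable_on_SucI[OF assms(1)])
    show "((\<lambda>x. L (f x)) has_derivative (\<lambda>v. L (frechet_derivative f (at x) v))) (at x)"
      if "x \<in> S" for x
      using Suc.prems[THEN higher_differentiable_on_has_derivative, OF that]
      by (rule bounded_linear.has_derivative[OF assms(2)])
    show "higher_differentiable_on S (\<lambda>x. L (frechet_derivative f (at x) v)) n" for v
      using Suc.prems by (intro Suc.IH) auto
  qed
qed

lemma has_derivative_real_scaleR:
  fixes f :: "real \<Rightarrow> 'a::real_normed_vector"
  assumes "(f has_derivative f') F"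
  shows "(f has_derivative (\<lambda>y. y *\<^sub>R f' 1)) F"
proof -
  have "f' = (\<lambda>y. y *\<^sub>R f' 1)"
  proof
    show "f' y = y *\<^sub>R f' 1" for y
      using linear_scale[OF has_derivative_linear[OF assms], of y 1] by simp
  qed
  from back_subst[of "\<lambda>h. (f has_derivative h) F", OF assms this] show ?thesis .
qed

text \<open>A real-valued inner map keeps the chain rule within the scope of the product rule: the
  derivative of the composite is a scalar multiple of one directional derivative, so no expansion
  in a basis is required.\<close>

lemma higher_differentiable_on_compose:
  fixes g :: "'a::real_normed_vector \<Rightarrow> real" and f :: "real \<Rightarrow> 'b::real_normed_vector"
  assumes "open S" "open T" "g ` S \<subseteq> T"
    and "higher_differentiable_on T f n" "higher_differentiable_on S g n"
  shows "higher_differentiable_on S (\<lambda>x. f (g x)) n"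
  using assms(4,5)
proof (induction n arbitrary: f)
  case 0
  then show ?case using assms(3) continuous_on_compose2[of T f S g] by auto
next
  case (Suc n)
  show ?case
  proof (rule higher_differentiable_on_SucI[OF assms(1)])
    show "((\<lambda>x. f (g x)) has_derivative
        (\<lambda>v. frechet_derivative g (at x) v *\<^sub>R frechet_derivative f (at (g x)) 1)) (at x)"
      if "x \<in> S" for x
    proof -
      have "(f has_derivative frechet_derivative f (at (g x))) (at (g x))"
        using assms(3) that Suc.prems(1) by (intro higher_differentiable_on_has_derivative) auto
      from has_derivative_compose[OF higher_differentiable_on_has_derivative[OF Suc.prems(2) that]
          has_derivative_real_scaleR[OF this]]
      show ?thesis .
    qed
    show "higher_differentiable_on S
        (\<lambda>x. frechet_derivative g (at x) v *\<^sub>R frechet_derivative f (at (g x)) 1) n" for v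
      using Suc.prems higher_differentiable_on_SucD[OF Suc.prems(2)]
      by (intro higher_differentiable_on_bilinear[OF assms(1) bounded_bilinear_scaleR] Suc.IH) auto
  qed
qed

lemma smooth_on_cong:
  "open S \<Longrightarrow> (\<And>x. x \<in> S \<Longrightarrow> f x = g x) \<Longrightarrow> smooth_on S f \<longleftrightarrow> smooth_on S g"
  unfolding smooth_on_def using higher_differentiable_on_cong by blast

lemma smooth_on_subset: "smooth_on S f \<Longrightarrow> T \<subseteq> S \<Longrightarrow> smooth_on T f"
  unfolding smooth_on_def using higher_differentiable_on_subset by blast

lemma smooth_on_const: "open S \<Longrightarrow> smooth_on S (\<lambda>x. c)"
  unfolding smooth_on_def using higher_differentiable_on_const by blast

lemma smooth_on_add:
  "open S \<Longrightarrow> smooth_on S f \<Longrightarrow> smooth_on S g \<Longrightarrow> smooth_on S (\<lambda>x. f x + g x)"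
  unfolding smooth_on_def using higher_differentiable_on_add by blast

lemma smooth_on_bilinear:
  "open S \<Longrightarrow> bounded_bilinear B \<Longrightarrow> smooth_on S f \<Longrightarrow> smooth_on S g \<Longrightarrow>
    smooth_on S (\<lambda>x. B (f x) (g x))"
  unfolding smooth_on_def using higher_differentiable_on_bilinear by blast

lemma smooth_on_linear:
  "open S \<Longrightarrow> bounded_linear L \<Longrightarrow> smooth_on S f \<Longrightarrow> smooth_on S (\<lambda>x. L (f x))"
  unfolding smooth_on_def using higher_differentiable_on_linear by blast

lemma smooth_on_compose:
  fixes g :: "'a::real_normed_vector \<Rightarrow> real"
  shows "open S \<Longrightarrow> open T \<Longrightarrow> g ` S \<subseteq> T \<Longrightarrow> smooth_on T f \<Longrightarrow> smooth_on S g \<Longrightarrow>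
    smooth_on S (\<lambda>x. f (g x))"
  unfolding smooth_on_def using higher_differentiable_on_compose by blast

lemma smooth_on_has_derivative:
  "smooth_on S f \<Longrightarrow> x \<in> S \<Longrightarrow> (f has_derivative frechet_derivative f (at x)) (at x)"
  unfolding smooth_on_def using higher_differentiable_on_has_derivative by blast

lemma smooth_on_continuous: "smooth_on S f \<Longrightarrow> continuous_on S f"
  unfolding smooth_on_def using higher_differentiable_on.simps(1) by blast

lemma smooth_onI_derivative:
  assumes "open S" "\<And>x. x \<in> S \<Longrightarrow> (f has_derivative f' x) (at x)"
    and "\<And>v. smooth_on S (\<lambda>x. f' x v)"
  shows "smooth_on S f"
  unfolding smooth_on_def
proof
  have "higher_differentiable_on S f (Suc n)" for n
    using assms by (intro higher_differentiable_on_SucI[OF assms(1,2)]) (auto simp: smooth_on_def)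
  then show "higher_differentiable_on S f n" for n
    using higher_differentiable_on_SucD by blast
qed

lemma smooth_on_id: "open S \<Longrightarrow> smooth_on S (\<lambda>x. x)"
  by (rule smooth_onI_derivative[where f' = "\<lambda>x v. v"]) (auto intro: smooth_on_const)

lemma smooth_on_cis: "smooth_on UNIV cis"
  unfolding smooth_on_def
proof
  have "((\<lambda>t. a * cis t) has_derivative (\<lambda>v. a * (v *\<^sub>R (\<i> * cis t)))) (at t)" for a t
    by (auto intro!: derivative_eq_intros)
  then have "higher_differentiable_on UNIV (\<lambda>t. a * cis t) n" for a n
  proof (induction n arbitrary: a)
    case (Suc n)
    have "higher_differentiable_on UNIV (\<lambda>t. a * (v *\<^sub>R (\<i> * cis t))) n" for v
      using Suc.IH[of "a * of_real v * \<i>"] Suc.prems by (simp add: scaleR_conv_of_real mult.assoc)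
    then show ?case using Suc.prems by (intro higher_differentiable_on_SucI) auto
  qed (auto intro!: continuous_intros)
  from this[of 1] show "higher_differentiable_on UNIV cis n" for n by simp
qed

lemma smooth_on_exp: "smooth_on UNIV (exp :: real \<Rightarrow> real)"
  unfolding smooth_on_def
proof
  have "higher_differentiable_on UNIV (\<lambda>t::real. a * exp t) n" for a n
  proof (induction n arbitrary: a)
    case (Suc n)
    have "((\<lambda>t. a * exp t) has_derivative (\<lambda>v. (v * a) * exp t)) (at t)" for t :: real
      by (auto intro!: derivative_eq_intros)
    then show ?case using Suc.IH by (intro higher_differentiable_on_SucI) auto
  qed (auto intro!: continuous_intros)
  from this[of 1] show "higher_differentiable_on UNIV (exp :: real \<Rightarrow> real) n" for n by simp
qed

lemma smooth_on_inverse: "smooth_on {0<..} (inverse :: real \<Rightarrow> real)"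
  unfolding smooth_on_def
proof
  show "higher_differentiable_on {0<..} (inverse :: real \<Rightarrow> real) n" for n
  proof (induction n)
    case (Suc n)
    have "higher_differentiable_on {0<..} (\<lambda>t. (- v) * (inverse t * inverse t)) n" for v :: real
      using Suc by (intro higher_differentiable_on_bilinear[OF _ bounded_bilinear_mult]
          higher_differentiable_on_const) simp_all
    moreover have "(inverse has_derivative (\<lambda>v. (- v) * (inverse t * inverse t))) (at t)"
      if "t \<in> {0<..}" for t :: real
      using that by (auto intro!: derivative_eq_intros)
    ultimately show ?case by (intro higher_differentiable_on_SucI) auto
  qed (auto intro!: continuous_intros)
qed

lemma smooth_on_vector_derivative:
  fixes f :: "real \<Rightarrow> 'a::real_normed_vector"
  assumes "smooth_on I f" "open I"
  shows "s \<in> I \<Longrightarrow> (f has_vector_derivative vector_derivative f (at s)) (at s)"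
    and "smooth_on I (\<lambda>s. vector_derivative f (at s))"
proof -
  have *: "(f has_vector_derivative vector_derivative f (at s)) (at s)" if "s \<in> I" for s
    using smooth_on_has_derivative[OF assms(1) that]
    by (meson differentiableI vector_derivative_works)
  then show "s \<in> I \<Longrightarrow> (f has_vector_derivative vector_derivative f (at s)) (at s)" .
  have "vector_derivative f (at s) = frechet_derivative f (at s) 1" if "s \<in> I" for s
    by (simp flip: frechet_derivative_at[OF *[OF that, unfolded has_vector_derivative_def]])
  moreover have "smooth_on I (\<lambda>s. frechet_derivative f (at s) 1)"
    unfolding smooth_on_def using assms(1) higher_differentiable_on.simps(2) smooth_on_def by blast
  ultimately show "smooth_on I (\<lambda>s. vector_derivative f (at s))"
    by (subst smooth_on_cong[OF assms(2)])
qed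

text \<open>Phases are found by integrating their prescribed derivatives; this keeps them smooth and
  defined on the whole interval.\<close>

lemma smooth_antiderivative:
  fixes f :: "real \<Rightarrow> real"
  assumes "open_interval I" "smooth_on I f"
  obtains g where "smooth_on I g" "\<And>s. s \<in> I \<Longrightarrow> (g has_real_derivative f s) (at s)"
proof -
  have I: "open I" "is_interval I" using assms by (auto simp: open_interval_def)
  obtain c where c: "c \<in> I" using assms by (auto simp: open_interval_def)
  define g where "g u = (LBINT y=c..u. f y)" for u :: real
  have g: "(g has_real_derivative f s) (at s)" if s: "s \<in> I" for s
  proof -
    obtain e where e: "e > 0" "ball c e \<subseteq> I" "ball s e \<subseteq> I"
    proof -
      obtain e1 e2 where "e1 > 0" "ball c e1 \<subseteq> I" "e2 > 0" "ball s e2 \<subseteq> I"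
        using I c s open_contains_ball by meson
      then show ?thesis by (intro that[of "min e1 e2"]) auto
    qed
    define a b where "a = min c s - e / 2" and "b = max c s + e / 2"
    have "c - e / 2 \<in> I" "c + e / 2 \<in> I" "s - e / 2 \<in> I" "s + e / 2 \<in> I"
      by (rule subsetD[OF e(2)] subsetD[OF e(3)], use e(1) in \<open>simp add: dist_real_def\<close>)+
    then have "a \<in> I" "b \<in> I"
      by (simp_all add: a_def b_def min_def max_def)
    then have ab: "{a..b} \<subseteq> I"
      using mem_is_interval_1_I[OF I(2)] by (meson atLeastAtMost_iff subsetI)
    have "a < s" "s < b" "a \<le> c" "c \<le> b" using e by (auto simp: a_def b_def)
    then have "(g has_vector_derivative f s) (at s within {a..b})"
      unfolding g_def
      by (intro interval_integral_FTC2 continuous_on_subset[OF smooth_on_continuous[OF assms(2)] ab]) auto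
    then have "(g has_vector_derivative f s) (at s)"
      using \<open>a < s\<close> \<open>s < b\<close> by (simp add: at_within_Icc_at)
    then show ?thesis by (simp add: has_real_derivative_iff_has_vector_derivative)
  qed
  have "smooth_on I g"
  proof (rule smooth_onI_derivative[OF I(1)])
    show "(g has_derivative (\<lambda>v. f s * v)) (at s)" if "s \<in> I" for s
      using g[OF that] by (simp add: has_field_derivative_def)
    show "smooth_on I (\<lambda>s. f s * v)" for v
      by (rule smooth_on_bilinear[OF I(1) bounded_bilinear_mult assms(2) smooth_on_const[OF I(1)]])
  qed
  from that[OF this g] show ?thesis .
qed

section \<open>Hermitian geometry of two-dimensional complex space\<close>

definition herm :: "complex ^ 2 \<Rightarrow> complex ^ 2 \<Rightarrow> complex" where
  "herm u v = u $ 1 * cnj (v $ 1) + u $ 2 * cnj (v $ 2)"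

lemma inner_herm: "u \<bullet> v = Re (herm u v)"
  by (simp add: inner_vec_def sum_2 inner_complex_def herm_def)

lemma herm_self: "herm u u = complex_of_real ((norm u)\<^sup>2)"
  by (simp add: complex_eq_iff power2_norm_eq_inner inner_herm) (simp add: herm_def)

lemma herm_add_left: "herm (a + b) v = herm a v + herm b v"
  and herm_add_right: "herm v (a + b) = herm v a + herm v b"
  and herm_diff_left: "herm (a - b) v = herm a v - herm b v"
  and herm_diff_right: "herm v (a - b) = herm v a - herm v b"
  and herm_smult_left: "herm (c *s a) v = c * herm a v"
  and herm_smult_right: "herm v (c *s a) = cnj c * herm v a"
  and herm_scaleR_left: "herm (r *\<^sub>R a) v = of_real r * herm a v"
  and herm_scaleR_right: "herm v (r *\<^sub>R a) = of_real r * herm v a"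
  by (simp_all add: herm_def algebra_simps scaleR_conv_of_real[where 'a = complex])

lemmas herm_simps = herm_add_left herm_add_right herm_diff_left herm_diff_right
  herm_smult_left herm_smult_right herm_scaleR_left herm_scaleR_right

lemma herm_commute: "herm v u = cnj (herm u v)"
  by (simp add: herm_def mult.commute)

text \<open>Bilinearity is over \<open>\<real>\<close>, which is what the real product rule and the calculus of smooth maps
  use.\<close>

lemma bounded_bilinear_herm: "bounded_bilinear herm"
  unfolding bilinear_conv_bounded_bilinear[symmetric] bilinear_def
  by (auto intro!: linearI simp: herm_simps scaleR_conv_of_real[where 'a = complex])

lemma bounded_bilinear_smult: "bounded_bilinear (\<lambda>(c::complex) (u :: complex ^ 2). c *s u)"
  unfolding bilinear_conv_bounded_bilinear[symmetric] bilinear_def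
  by (auto intro!: linearI simp: vec_eq_iff forall_2 algebra_simps scaleR_conv_of_real[where 'a = complex])

text \<open>The norm-preserving choice of a vector Hermitian orthogonal to \<open>v\<close>: the quaternionic
  structure of \<open>\<complex>\<^sup>2\<close>.\<close>

definition orth :: "complex ^ 2 \<Rightarrow> complex ^ 2" where
  "orth v = vector [- cnj (v $ 2), cnj (v $ 1)]"

lemma herm_orth_left: "herm (orth v) v = 0"
  by (simp add: herm_def orth_def)

lemma herm_orth_self: "herm (orth v) (orth v) = herm v v"
  by (simp add: herm_def orth_def algebra_simps)

lemma orth_decomposition:
  assumes "norm v = 1"
  shows "w = herm w (orth v) *s orth v + herm w v *s v"
proof -
  have 1: "v $ 1 * cnj (v $ 1) + v $ 2 * cnj (v $ 2) = 1"
    using herm_self[of v] assms by (simp add: herm_def)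
  have "w $ 1 = w $ 1 * (v $ 1 * cnj (v $ 1) + v $ 2 * cnj (v $ 2))"
    "w $ 2 = w $ 2 * (v $ 1 * cnj (v $ 1) + v $ 2 * cnj (v $ 2))"
    unfolding 1 by simp_all
  then show ?thesis
    by (simp add: vec_eq_iff forall_2 herm_def orth_def algebra_simps)
qed

text \<open>The congruence is the matrix with columns \<open>a\<close> and \<open>b\<close>.\<close>

lemma unitary_frame:
  assumes "herm a a = 1" "herm b b = 1" "herm a b = 0"
  obtains U where "U \<in> U2" "\<And>x y. U *v vector [x, y] = x *s a + y *s b"
proof
  define U :: "complex ^ 2 ^ 2" where "U = (\<chi> i j. if j = 1 then a $ i else b $ i)"
  have "herm b a = 0" using assms(3) herm_commute[of b a] by simp
  then show "U \<in> U2"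
    using assms unfolding U2_def herm_def
    by (auto simp: vec_eq_iff forall_2 matrix_matrix_mult_def map_matrix_def transpose_def mat_def
        sum_2 U_def algebra_simps)
  show "U *v vector [x, y] = x *s a + y *s b" for x y
    by (simp add: U_def vec_eq_iff forall_2 matrix_vector_mult_def sum_2 algebra_simps)
qed

text \<open>The determinant of \<open>w\<close> and \<open>w'\<close> is the obstruction to the curve \<open>w\<close> staying on a complex line.\<close>

definition cdet :: "complex ^ 2 \<Rightarrow> complex ^ 2 \<Rightarrow> complex" where
  "cdet v w = v $ 1 * w $ 2 - v $ 2 * w $ 1"

lemma bounded_bilinear_cdet: "bounded_bilinear cdet"
  unfolding bilinear_conv_bounded_bilinear[symmetric] bilinear_def
  by (auto intro!: linearI simp: cdet_def algebra_simps scaleR_conv_of_real[where 'a = complex])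

text \<open>The factor is the coefficient of the orthogonal projection, so along a smooth curve it depends
  smoothly on the parameter.\<close>

lemma cdet_eq_0_imp_smult:
  assumes "cdet v w = 0" "v \<noteq> 0"
  shows "w = (herm w v / complex_of_real ((norm v)\<^sup>2)) *s v"
proof -
  have "herm v v \<noteq> 0" using assms(2) by (simp add: herm_self)
  moreover have "herm v v *s w = herm w v *s v"
  proof -
    have *: "v $ 1 * w $ 2 = v $ 2 * w $ 1" using assms(1) by (simp add: cdet_def)
    have "herm v v * w $ 1 = herm w v * v $ 1 - cnj (v $ 2) * (v $ 1 * w $ 2 - v $ 2 * w $ 1)"
      by (simp add: herm_def algebra_simps)
    moreover have "herm v v * w $ 2 = herm w v * v $ 2 + cnj (v $ 1) * (v $ 1 * w $ 2 - v $ 2 * w $ 1)"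
      by (simp add: herm_def algebra_simps)
    ultimately show ?thesis using * by (simp add: vec_eq_iff forall_2)
  qed
  ultimately show ?thesis
    unfolding herm_self[symmetric] by (simp add: vec_eq_iff forall_2 field_simps)
qed

text \<open>In \<open>\<complex>\<^sup>2\<close> the vectors orthogonal to a nonzero vector form a single complex line.\<close>

lemma cdet_herm_eq_0:
  assumes "herm v u = 0" "herm w u = 0" "u \<noteq> 0"
  shows "cdet v w = 0"
proof -
  have "cdet v w * cnj (u $ 1) = w $ 2 * herm v u - v $ 2 * herm w u"
    "cdet v w * cnj (u $ 2) = v $ 1 * herm w u - w $ 1 * herm v u"
    by (simp_all add: cdet_def herm_def algebra_simps)
  with assms show ?thesis by (auto simp: vec_eq_iff forall_2)
qed

section \<open>Circles and the Lagrangian condition\<close>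

definition circle_family :: "(real \<Rightarrow> complex ^ 2) \<Rightarrow> (real \<Rightarrow> complex ^ 2) \<Rightarrow> real \<times> real \<Rightarrow> complex ^ 2"
  where "circle_family u v z = cis (snd z) *s u (fst z) + cis (- snd z) *s v (fst z)"

lemma circle_family_has_derivative:
  assumes "(u has_vector_derivative u') (at s)" "(v has_vector_derivative v') (at s)"
  shows "(circle_family u v has_derivative (\<lambda>h.
      fst h *\<^sub>R (cis t *s u' + cis (- t) *s v') +
      snd h *\<^sub>R (\<i> *s (cis t *s u s - cis (- t) *s v s)))) (at (s, t))"
proof -
  have comp: "((\<lambda>z. w (fst z)) has_derivative (\<lambda>h. fst h *\<^sub>R w')) (at (s, t))"
    if "(w has_vector_derivative w') (at s)" for w and w' :: "complex ^ 2"
    using has_derivative_compose[of fst fst "(s, t)" UNIV w "\<lambda>x. x *\<^sub>R w'"] that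
    by (simp add: has_vector_derivative_def has_derivative_fst[OF has_derivative_ident])
  have cis: "((\<lambda>z. cis (snd z)) has_derivative (\<lambda>h. snd h *\<^sub>R (\<i> * cis t))) (at (s, t))"
    "((\<lambda>z. cis (- snd z)) has_derivative (\<lambda>h. (- snd h) *\<^sub>R (\<i> * cis (- t)))) (at (s, t))"
    by (auto intro!: derivative_eq_intros)
  note FD = bounded_bilinear.FDERIV[OF bounded_bilinear_smult]
  show ?thesis
    unfolding circle_family_def[abs_def]
    by (rule has_derivative_eq_rhs[OF has_derivative_add[OF FD[OF cis(1) comp[OF assms(1)]]
            FD[OF cis(2) comp[OF assms(2)]]]])
      (simp add: fun_eq_iff vec_eq_iff forall_2 algebra_simps scaleR_conv_of_real[where 'a = complex])
qed

lemma smooth_on_circle_family_reparam: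
  fixes g :: "real \<times> real \<Rightarrow> real"
  assumes "open I" "smooth_on I u" "smooth_on I v" "smooth_on (I \<times> UNIV) g"
  shows "smooth_on (I \<times> UNIV) (\<lambda>z. circle_family u v (fst z, g z))"
proof -
  have op: "open (I \<times> (UNIV :: real set))" using assms(1) by (simp add: open_Times)
  have fst: "smooth_on (I \<times> UNIV) (fst :: real \<times> real \<Rightarrow> real)"
    using smooth_on_linear[OF op bounded_linear_fst smooth_on_id[OF op]] by simp
  have neg: "smooth_on (I \<times> UNIV) (\<lambda>z. - g z)"
    by (rule smooth_on_linear[OF op bounded_linear_minus[OF bounded_linear_ident] assms(4)])
  have w: "smooth_on (I \<times> (UNIV :: real set)) (\<lambda>z. w (fst z))"
    if "smooth_on I w" for w :: "real \<Rightarrow> complex ^ 2"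
    by (rule smooth_on_compose[OF op assms(1) _ that fst]) auto
  have c: "smooth_on (I \<times> (UNIV :: real set)) (\<lambda>z. cis (g z))"
    if "smooth_on (I \<times> UNIV) g" for g
    by (rule smooth_on_compose[OF op open_UNIV _ smooth_on_cis that]) auto
  show ?thesis
    unfolding circle_family_def fst_conv snd_conv
    by (rule smooth_on_add[OF op]; rule smooth_on_bilinear[OF op bounded_bilinear_smult])
      (rule c[OF assms(4)] c[OF neg] w[OF assms(2)] w[OF assms(3)])+
qed

text \<open>A centered circle is \<open>t \<mapsto> e\<^sup>i\<^sup>t u + e\<^sup>-\<^sup>i\<^sup>t v\<close>; having constant distance to the
  origin means that \<open>u\<close> and \<open>v\<close> are Hermitian orthogonal.\<close>

lemma centered_circles_Fourier:
  assumes "centered_circles I X" "open I"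
  obtains u v where "smooth_on I u" "smooth_on I v"
    "\<And>s. s \<in> I \<Longrightarrow> herm (u s) (v s) = 0" "\<And>s. s \<in> I \<Longrightarrow> u s \<noteq> 0 \<or> v s \<noteq> 0"
    "\<And>s t. s \<in> I \<Longrightarrow> X s t = circle_family u v (s, t)"
proof -
  obtain r e1 e2 where sm: "smooth_on I (r :: real \<Rightarrow> real)" "smooth_on I e1" "smooth_on I e2"
    and fr: "\<And>s. s \<in> I \<Longrightarrow> r s > 0 \<and> norm (e1 s) = 1 \<and> norm (e2 s) = 1 \<and> e1 s \<bullet> e2 s = 0"
    and X: "\<And>s t. s \<in> I \<Longrightarrow> X s t = r s *\<^sub>R (cos t *\<^sub>R e1 s + sin t *\<^sub>R e2 s)"
    using assms(1) unfolding centered_circles_def by metis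
  \<comment> \<open>Since \<open>e\<^sub>1 cos t + e\<^sub>2 sin t = e\<^sup>i\<^sup>t (e\<^sub>1 - i e\<^sub>2) / 2 + e\<^sup>-\<^sup>i\<^sup>t (e\<^sub>1 + i e\<^sub>2) / 2\<close>, the two curves
    are the values of \<open>w\<close> at \<open>-i/2\<close> and \<open>i/2\<close>.\<close>
  define w where "w c s = r s *\<^sub>R ((1 / 2 :: complex) *s e1 s + (c::complex) *s e2 s)" for c s
  have sm_w: "smooth_on I (w c)" for c
    unfolding w_def[abs_def]
    by (rule smooth_on_bilinear[OF assms(2) bounded_bilinear_scaleR sm(1)]
        smooth_on_add[OF assms(2)]
        smooth_on_bilinear[OF assms(2) bounded_bilinear_smult smooth_on_const[OF assms(2)]] sm)+
  show thesis
  proof (rule that[OF sm_w sm_w])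
    fix s assume s: "s \<in> I"
    have h: "herm (e1 s) (e1 s) = 1" "herm (e2 s) (e2 s) = 1"
      using fr[OF s] by (simp_all add: herm_self)
    have re: "herm (e2 s) (e1 s) + herm (e1 s) (e2 s) = 0"
      using fr[OF s] herm_commute[of "e2 s" "e1 s"] by (simp add: inner_herm complex_eq_iff)
    have "herm (w (- \<i> / 2) s) (w (\<i> / 2) s) =
        - (\<i> / 4) * (r s)\<^sup>2 * (herm (e2 s) (e1 s) + herm (e1 s) (e2 s))"
      by (simp add: w_def herm_simps h algebra_simps power2_eq_square)
    then show "herm (w (- \<i> / 2) s) (w (\<i> / 2) s) = 0" using re by simp
    have "w (- \<i> / 2) s + w (\<i> / 2) s = r s *\<^sub>R e1 s"
      by (simp add: w_def vec_eq_iff forall_2 algebra_simps)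
    moreover have "r s *\<^sub>R e1 s \<noteq> 0" using fr[OF s] by auto
    ultimately show "w (- \<i> / 2) s \<noteq> 0 \<or> w (\<i> / 2) s \<noteq> 0" by auto
    show "X s t = circle_family (w (- \<i> / 2)) (w (\<i> / 2)) (s, t)" for t
      by (simp add: X[OF s] circle_family_def w_def vec_eq_iff forall_2 complex_eq_iff
          field_simps)
  qed
qed

text \<open>The left-hand side is \<open>\<langle>X\<^sub>s, J X\<^sub>t\<rangle>\<close>; the right-hand side is its Fourier expansion in \<open>t\<close>,
  which has only the frequencies \<open>0\<close> and \<open>2\<close>.\<close>

lemma inner_circle_family_tangents:
  "(cis t *s u' + cis (- t) *s v') \<bullet> (\<i> *s (\<i> *s (cis t *s u - cis (- t) *s v))) =
    Re (herm v' v) - Re (herm u' u) + Re (cis (2 * t) * (herm u' v - cnj (herm v' u)))"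
proof -
  have c: "cis t * cnj (cis t) = 1" "cis (- t) * cnj (cis (- t)) = 1"
    "cis t * cnj (cis (- t)) = cis (2 * t)" "cis (- t) * cnj (cis t) = cnj (cis (2 * t))"
    by (simp_all add: cis_cnj cis_mult)
  have "herm (cis t *s u' + cis (- t) *s v') (\<i> *s (\<i> *s (cis t *s u - cis (- t) *s v))) =
     - ((cis t * cnj (cis t)) * herm u' u) + (cis t * cnj (cis (- t))) * herm u' v
      - (cis (- t) * cnj (cis t)) * herm v' u + (cis (- t) * cnj (cis (- t))) * herm v' v"
    by (simp add: herm_simps algebra_simps)
  also have "\<dots> = - herm u' u + cis (2 * t) * herm u' v - cnj (cis (2 * t)) * herm v' u + herm v' v"
    unfolding c by simp
  finally have *: "herm (cis t *s u' + cis (- t) *s v') (\<i> *s (\<i> *s (cis t *s u - cis (- t) *s v))) =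
    - herm u' u + cis (2 * t) * herm u' v - cnj (cis (2 * t)) * herm v' u + herm v' v" .
  show ?thesis
    unfolding inner_herm * by (simp add: algebra_simps)
qed

lemma lagrangian_circle_family_herm:
  assumes "\<And>t. (cis t *s u' + cis (- t) *s v') \<bullet> (\<i> *s (\<i> *s (cis t *s u - cis (- t) *s v))) = 0"
  shows "Re (herm u' u) = Re (herm v' v)" "herm u' v = cnj (herm v' u)"
proof -
  define a b where "a = Re (herm v' v) - Re (herm u' u)" and "b = herm u' v - cnj (herm v' u)"
  have *: "a + Re (cis (2 * t) * b) = 0" for t
    using assms[of t] unfolding inner_circle_family_tangents a_def b_def .
  \<comment> \<open>The values \<open>1\<close>, \<open>-1\<close> and \<open>\<i>\<close> of \<open>e\<^sup>2\<^sup>i\<^sup>t\<close> separate the three real coefficients.\<close>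
  have "a + Re b = 0" "a - Re b = 0" "a - Im b = 0"
    using *[of 0] *[of "pi / 2"] *[of "pi / 4"] by simp_all
  then have "a = 0" "b = 0" by (auto simp: complex_eq_iff)
  then show "Re (herm u' u) = Re (herm v' v)" "herm u' v = cnj (herm v' u)"
    by (simp_all add: a_def b_def)
qed

section \<open>Curves on a complex line and phase normalization\<close>

lemma smult_has_vector_derivative:
  fixes a :: "real \<Rightarrow> complex" and w :: "real \<Rightarrow> complex ^ 2"
  assumes "(a has_vector_derivative a') (at s)" "(w has_vector_derivative w') (at s)"
  shows "((\<lambda>s. a s *s w s) has_vector_derivative (a s *s w' + a' *s w s)) (at s)"
  by (rule bounded_bilinear.has_vector_derivative[OF bounded_bilinear_smult assms])

lemma cis_has_vector_derivative:
  assumes "(\<theta> has_real_derivative d) (at s)"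
  shows "((\<lambda>s. cis (\<theta> s)) has_vector_derivative (of_real d * (\<i> * cis (\<theta> s)))) (at s)"
  using assms unfolding has_vector_derivative_def has_field_derivative_def
  by (auto intro!: derivative_eq_intros simp: fun_eq_iff scaleR_conv_of_real[where 'a = complex])

lemma smooth_on_cis_compose: "open I \<Longrightarrow> smooth_on I \<theta> \<Longrightarrow> smooth_on I (\<lambda>s. cis (\<theta> s))"
  by (rule smooth_on_compose[OF _ open_UNIV _ smooth_on_cis]) auto

lemma smooth_on_uminus: "open I \<Longrightarrow> smooth_on I f \<Longrightarrow> smooth_on I (\<lambda>s. - f s)"
  by (rule smooth_on_linear[OF _ bounded_linear_minus[OF bounded_linear_ident]])

lemma smooth_on_divide:
  fixes f g :: "real \<Rightarrow> real"
  assumes "open I" "smooth_on I f" "smooth_on I g" "\<And>s. s \<in> I \<Longrightarrow> g s > 0"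
  shows "smooth_on I (\<lambda>s. f s / g s)"
proof -
  have "smooth_on I (\<lambda>s. inverse (g s))"
    by (rule smooth_on_compose[OF assms(1) _ _ smooth_on_inverse assms(3)]) (use assms(4) in auto)
  from smooth_on_bilinear[OF assms(1) bounded_bilinear_mult assms(2) this]
  show ?thesis by (simp add: divide_inverse)
qed

lemma constant_if_vector_derivative_0:
  fixes f :: "real \<Rightarrow> 'a::real_normed_vector"
  assumes "open_interval I" "\<And>s. s \<in> I \<Longrightarrow> (f has_vector_derivative 0) (at s)"
  obtains c where "\<And>s. s \<in> I \<Longrightarrow> f s = c"
proof -
  have "convex I" using assms(1) by (simp add: open_interval_def is_interval_convex)
  then show thesis
    using has_vector_derivative_zero_constant[of I f] assms(2) that
    by (meson has_vector_derivative_at_within)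
qed

text \<open>Where \<open>w\<close> and \<open>w'\<close> are complex dependent, \<open>w' = \<lambda> w\<close> with the smooth factor
  \<open>\<lambda> = \<langle>w', w\<rangle> / \<bar>w\<bar>\<^sup>2\<close>, so that \<open>w\<close> is the exponential of an antiderivative of \<open>\<lambda>\<close>
  times a constant vector.\<close>

lemma curve_on_complex_line:
  assumes "open_interval I" "smooth_on I w"
    and "\<And>s. s \<in> I \<Longrightarrow> w s \<noteq> 0" "\<And>s. s \<in> I \<Longrightarrow> cdet (w s) (vector_derivative w (at s)) = 0"
  obtains x y :: "real \<Rightarrow> real" and w0 where "smooth_on I x" "smooth_on I y" "norm w0 = 1"
    "\<And>s. s \<in> I \<Longrightarrow> w s = (of_real (exp (x s)) * cis (y s)) *s w0"
proof -
  have I: "open I" using assms(1) by (simp add: open_interval_def)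
  note wd = smooth_on_vector_derivative[OF assms(2) I]
  define h where "h s = herm (vector_derivative w (at s)) (w s)" for s
  define n where "n s = w s \<bullet> w s" for s
  have sh: "smooth_on I h"
    unfolding h_def by (rule smooth_on_bilinear[OF I bounded_bilinear_herm wd(2) assms(2)])
  have sn: "smooth_on I n"
    unfolding n_def by (rule smooth_on_bilinear[OF I bounded_bilinear_inner assms(2) assms(2)])
  have n: "n s > 0" if "s \<in> I" for s using assms(3)[OF that] by (simp add: n_def)
  obtain x where x: "smooth_on I x" "\<And>s. s \<in> I \<Longrightarrow> (x has_real_derivative Re (h s) / n s) (at s)"
    using smooth_antiderivative[OF assms(1)
        smooth_on_divide[OF I smooth_on_linear[OF I bounded_linear_Re sh] sn n]] by blast
  obtain y where y: "smooth_on I y" "\<And>s. s \<in> I \<Longrightarrow> (y has_real_derivative Im (h s) / n s) (at s)"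
    using smooth_antiderivative[OF assms(1)
        smooth_on_divide[OF I smooth_on_linear[OF I bounded_linear_Im sh] sn n]] by blast
  \<comment> \<open>The integrating factor of \<open>w' = (h / n) w\<close>.\<close>
  define e where "e s = of_real (exp (- x s)) * cis (- y s)" for s
  have "((\<lambda>s. e s *s w s) has_vector_derivative 0) (at s)" if s: "s \<in> I" for s
  proof -
    have "((\<lambda>s. of_real (exp (- x s)) :: complex) has_vector_derivative
        of_real (- (exp (- x s) * (Re (h s) / n s)))) (at s)"
      by (rule has_vector_derivative_of_real, rule DERIV_cong[OF DERIV_fun_exp[OF DERIV_minus[OF x(2)[OF s]]]]) simp
    moreover have "((\<lambda>s. cis (- y s)) has_vector_derivative
        (of_real (- (Im (h s) / n s)) * (\<i> * cis (- y s)))) (at s)"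
      by (rule cis_has_vector_derivative) (intro derivative_intros y(2)[OF s])
    ultimately have "(e has_vector_derivative
        (of_real (exp (- x s)) * (of_real (- (Im (h s) / n s)) * (\<i> * cis (- y s))) +
         of_real (- (exp (- x s) * (Re (h s) / n s))) * cis (- y s))) (at s)"
      unfolding e_def[abs_def] by (rule has_vector_derivative_mult)
    moreover have "h s / of_real (n s) = of_real (Re (h s) / n s) + \<i> * of_real (Im (h s) / n s)"
      using n[OF s] by (simp add: complex_eq_iff)
    ultimately have e: "(e has_vector_derivative (- (h s / of_real (n s)) * e s)) (at s)"
      by (simp only: e_def) (simp add: algebra_simps)
    have w: "vector_derivative w (at s) = (h s / of_real (n s)) *s w s"
      using cdet_eq_0_imp_smult[OF assms(4)[OF s] assms(3)[OF s]]
      by (simp add: h_def n_def power2_norm_eq_inner)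
    show ?thesis
      using smult_has_vector_derivative[OF e wd(1)[OF s]]
      by (simp add: w vec_eq_iff forall_2 vector_smult_assoc) (simp add: algebra_simps)
  qed
  then obtain k where k: "\<And>s. s \<in> I \<Longrightarrow> e s *s w s = k"
    using constant_if_vector_derivative_0[OF assms(1)] by blast
  have wk: "w s = (of_real (exp (x s)) * cis (y s)) *s k" if "s \<in> I" for s
  proof -
    have "(of_real (exp (x s)) * cis (y s)) * e s =
        of_real (exp (x s) * exp (- x s)) * (cis (y s) * cis (- y s))"
      by (simp add: e_def)
    also have "\<dots> = 1" by (simp add: cis_mult flip: exp_add)
    finally show ?thesis
      using k[OF that] by (metis vector_smult_assoc vector_smult_lid)
  qed
  obtain s0 where s0: "s0 \<in> I" using assms(1) by (auto simp: open_interval_def)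
  have k0: "k \<noteq> 0" using wk[OF s0] assms(3)[OF s0] by auto
  show thesis
  proof (rule that)
    show "smooth_on I (\<lambda>s. x s + ln (norm k))" by (intro smooth_on_add smooth_on_const I x)
    show "smooth_on I y" by fact
    show "norm (inverse (norm k) *\<^sub>R k) = 1" using k0 by simp
    show "w s = (of_real (exp (x s + ln (norm k))) * cis (y s)) *s (inverse (norm k) *\<^sub>R k)"
      if "s \<in> I" for s
      using k0 wk[OF that]
      by (simp add: exp_add vec_eq_iff forall_2 scaleR_conv_of_real[where 'a = complex])
  qed
qed

lemma phase_derivative:
  fixes a :: "real \<Rightarrow> complex"
  assumes "(\<theta> has_real_derivative d) (at s)" "(a has_vector_derivative a') (at s)"
  shows "((\<lambda>s. cis (\<theta> s) * a s) has_vector_derivative (cis (\<theta> s) * (a' + \<i> * of_real d * a s))) (at s)"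
  using has_vector_derivative_mult[OF cis_has_vector_derivative[OF assms(1)] assms(2)]
  by (simp add: algebra_simps)

text \<open>Multiplying a curve of the sphere by a phase \<open>e\<^sup>i\<^sup>\<theta>\<close> changes \<open>\<langle>\<gamma>', J\<gamma>\<rangle>\<close> by \<open>\<theta>'\<close>:
  every curve can be rotated along the Hopf fibres into a Legendrian one.\<close>

lemma legendrian_S3_phase:
  assumes "open_interval I" "smooth_on I w" "\<And>s. s \<in> I \<Longrightarrow> norm (w s) = 1"
  obtains \<theta> where "smooth_on I \<theta>" "legendrian_S3 I (\<lambda>s. cis (\<theta> s) *s w s)"
proof -
  have I: "open I" using assms(1) by (simp add: open_interval_def)
  note wd = smooth_on_vector_derivative[OF assms(2) I]
  define h where "h s = herm (vector_derivative w (at s)) (w s)" for s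
  have "smooth_on I h"
    unfolding h_def by (rule smooth_on_bilinear[OF I bounded_bilinear_herm wd(2) assms(2)])
  then obtain \<theta> where \<theta>: "smooth_on I \<theta>" "\<And>s. s \<in> I \<Longrightarrow> (\<theta> has_real_derivative - Im (h s)) (at s)"
    using smooth_antiderivative[OF assms(1) smooth_on_uminus[OF I smooth_on_linear[OF I bounded_linear_Im]]]
    by blast
  have "legendrian_S3 I (\<lambda>s. cis (\<theta> s) *s w s)"
    unfolding legendrian_S3_def
  proof (intro conjI ballI)
    show "smooth_on I (\<lambda>s. cis (\<theta> s) *s w s)"
      by (rule smooth_on_bilinear[OF I bounded_bilinear_smult smooth_on_cis_compose[OF I \<theta>(1)] assms(2)])
    fix s assume s: "s \<in> I"
    let ?g = "\<lambda>s. cis (\<theta> s) *s w s"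
    have ww: "herm (w s) (w s) = 1" using assms(3)[OF s] by (simp add: herm_self)
    have cc: "cis (\<theta> s) * cnj (cis (\<theta> s)) = 1" by (simp add: cis_cnj cis_mult)
    have "herm (?g s) (?g s) = (cis (\<theta> s) * cnj (cis (\<theta> s))) * herm (w s) (w s)"
      by (simp add: herm_simps)
    then have "(norm (?g s))\<^sup>2 = 1"
      unfolding ww cc by (simp add: herm_self complex_eq_iff)
    then show "norm (?g s) = 1" using norm_ge_zero[of "?g s"] by (simp add: power2_eq_1_iff)
    have D: "vector_derivative ?g (at s) = cis (\<theta> s) *s vector_derivative w (at s)
        + (of_real (- Im (h s)) * (\<i> * cis (\<theta> s))) *s w s"
      by (rule vector_derivative_at[OF smult_has_vector_derivative[OF
            cis_has_vector_derivative[OF \<theta>(2)[OF s]] wd(1)[OF s]]])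
    have "herm (vector_derivative ?g (at s)) (\<i> *s ?g s) =
        - \<i> * (cis (\<theta> s) * cnj (cis (\<theta> s))) * (h s - \<i> * of_real (Im (h s)) * herm (w s) (w s))"
      unfolding D by (simp add: herm_simps h_def algebra_simps)
    also have "\<dots> = - \<i> * of_real (Re (h s))"
      unfolding ww cc by (simp add: complex_eq_iff)
    finally show "vector_derivative ?g (at s) \<bullet> (\<i> *s ?g s) = 0"
      by (simp add: inner_herm)
  qed
  with \<theta>(1) show thesis by (rule that)
qed

text \<open>The same for the opposite phases \<open>e\<^sup>i\<^sup>\<theta>\<close>, \<open>e\<^sup>-\<^sup>i\<^sup>\<theta>\<close> on the two coordinates:
  the indefinite form changes by \<open>\<theta>' (\<bar>a\<bar>\<^sup>2 + \<bar>b\<bar>\<^sup>2)\<close>, whose second factor is positive.\<close>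

lemma legendrian_AdS_phase:
  fixes a b :: "real \<Rightarrow> complex"
  assumes "open_interval I" "smooth_on I a" "smooth_on I b"
    and "\<And>s. s \<in> I \<Longrightarrow> (cmod (a s))\<^sup>2 - (cmod (b s))\<^sup>2 = - 1"
  obtains \<theta> where "smooth_on I \<theta>"
    "legendrian_AdS I (\<lambda>s. vector [cis (\<theta> s) * a s, cis (- \<theta> s) * b s])"
proof -
  have I: "open I" using assms(1) by (simp add: open_interval_def)
  note ad = smooth_on_vector_derivative[OF assms(2) I]
  note bd = smooth_on_vector_derivative[OF assms(3) I]
  define a' where "a' s = vector_derivative a (at s)" for s
  define b' where "b' s = vector_derivative b (at s)" for s
  define d where "d s = (b' s \<bullet> (\<i> * b s) - a' s \<bullet> (\<i> * a s)) / (a s \<bullet> a s + b s \<bullet> b s)" for s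
  have pos: "a s \<bullet> a s + b s \<bullet> b s > 0" if "s \<in> I" for s
    using assms(4)[OF that] unfolding power2_norm_eq_inner
    by (smt (verit) inner_ge_zero)
  have sd: "smooth_on I d"
    unfolding d_def
  proof (rule smooth_on_divide[OF I _ _ pos])
    have mult: "smooth_on I (\<lambda>s. \<i> * f s)" if "smooth_on I f" for f
      by (rule smooth_on_bilinear[OF I bounded_bilinear_mult smooth_on_const[OF I] that])
    note inner = smooth_on_bilinear[OF I bounded_bilinear_inner]
    have "smooth_on I (\<lambda>s. b' s \<bullet> (\<i> * b s) + - (a' s \<bullet> (\<i> * a s)))"
      unfolding a'_def b'_def
      by (rule smooth_on_add[OF I inner smooth_on_uminus[OF I inner]])
        (rule ad(2) bd(2) mult assms(2,3))+
    then show "smooth_on I (\<lambda>s. b' s \<bullet> (\<i> * b s) - a' s \<bullet> (\<i> * a s))" by simp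
    show "smooth_on I (\<lambda>s. a s \<bullet> a s + b s \<bullet> b s)"
      by (rule smooth_on_add[OF I inner inner]) (rule assms(2,3))+
  qed
  obtain \<theta> where \<theta>: "smooth_on I \<theta>" "\<And>s. s \<in> I \<Longrightarrow> (\<theta> has_real_derivative d s) (at s)"
    using smooth_antiderivative[OF assms(1) sd] by blast
  define A B where "A s = cis (\<theta> s) * a s" and "B s = cis (- \<theta> s) * b s" for s
  have vec: "vector [x, y] = x *s vector [1, 0] + y *s (vector [0, 1] :: complex ^ 2)" for x y
    by (simp add: vec_eq_iff forall_2)
  have "legendrian_AdS I (\<lambda>s. vector [A s, B s])"
    unfolding legendrian_AdS_def
  proof (intro conjI ballI)
    have "smooth_on I A" "smooth_on I B"
      unfolding A_def[abs_def] B_def[abs_def]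
      by (rule smooth_on_bilinear[OF I bounded_bilinear_mult], rule smooth_on_cis_compose[OF I],
          (rule smooth_on_uminus[OF I] \<theta>(1) assms(2,3))+)+
    then show "smooth_on I (\<lambda>s. vector [A s, B s] :: complex ^ 2)"
      unfolding vec[of "A _"]
      by (intro smooth_on_add[OF I] smooth_on_bilinear[OF I bounded_bilinear_smult] smooth_on_const[OF I])
    fix s assume s: "s \<in> I"
    show "vector [A s, B s] \<in> anti_de_Sitter"
      using assms(4)[OF s] by (simp add: anti_de_Sitter_def A_def B_def norm_mult)
    define A' B' where "A' = cis (\<theta> s) * (a' s + \<i> * of_real (d s) * a s)"
      and "B' = cis (- \<theta> s) * (b' s + \<i> * of_real (- d s) * b s)"
    have dA: "(A has_vector_derivative A') (at s)"
      unfolding A_def[abs_def] A'_def a'_def by (rule phase_derivative[OF \<theta>(2)[OF s] ad(1)[OF s]])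
    have dB: "(B has_vector_derivative B') (at s)"
      unfolding B_def[abs_def] B'_def b'_def
      by (rule phase_derivative[OF DERIV_minus[OF \<theta>(2)[OF s]] bd(1)[OF s]])
    have "((\<lambda>s. vector [A s, B s]) has_vector_derivative
        ((A s *s 0 + A' *s vector [1, 0]) + (B s *s 0 + B' *s (vector [0, 1] :: complex ^ 2)))) (at s)"
      unfolding vec[of "A _"]
      by (rule has_vector_derivative_add[OF smult_has_vector_derivative[OF dA has_vector_derivative_const]
            smult_has_vector_derivative[OF dB has_vector_derivative_const]])
    then have D: "vector_derivative (\<lambda>s. vector [A s, B s]) (at s) =
        A' *s vector [1, 0] + B' *s (vector [0, 1] :: complex ^ 2)"
      using vector_derivative_at by fastforce
    have rot: "(cis \<alpha> * z) \<bullet> (\<i> * (cis \<alpha> * w)) = z \<bullet> (\<i> * w)" for \<alpha> z w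
    proof -
      have cc: "cis \<alpha> * cnj (cis \<alpha>) = 1" by (simp add: cis_cnj cis_mult)
      have ic: "x \<bullet> y = Re (x * cnj y)" for x y :: complex by (simp add: inner_complex_def)
      have "(cis \<alpha> * z) * cnj (\<i> * (cis \<alpha> * w)) = (cis \<alpha> * cnj (cis \<alpha>)) * (z * cnj (\<i> * w))"
        by (simp add: algebra_simps)
      also have "\<dots> = z * cnj (\<i> * w)" unfolding cc by simp
      finally show ?thesis unfolding ic by (rule arg_cong)
    qed
    have i: "(\<i> * of_real r * z) \<bullet> (\<i> * z) = r * (z \<bullet> z)" for r z
      by (simp add: inner_complex_def algebra_simps)
    have "A' \<bullet> (\<i> * A s) = a' s \<bullet> (\<i> * a s) + d s * (a s \<bullet> a s)"
      unfolding A'_def A_def rot inner_add_left i ..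
    moreover have "B' \<bullet> (\<i> * B s) = b' s \<bullet> (\<i> * b s) + (- d s) * (b s \<bullet> b s)"
      unfolding B'_def B_def rot inner_add_left i ..
    moreover have "d s * (a s \<bullet> a s + b s \<bullet> b s) = b' s \<bullet> (\<i> * b s) - a' s \<bullet> (\<i> * a s)"
      using pos[OF s] by (simp add: d_def)
    ultimately have "A' \<bullet> (\<i> * A s) - B' \<bullet> (\<i> * B s) = 0"
      by (simp add: algebra_simps)
    then show "(vector_derivative (\<lambda>s. vector [A s, B s] :: complex ^ 2) (at s) $ 1) \<bullet> (\<i> * vector [A s, B s] $ 1) -
        (vector_derivative (\<lambda>s. vector [A s, B s] :: complex ^ 2) (at s) $ 2) \<bullet> (\<i> * (vector [A s, B s] :: complex ^ 2) $ 2) = 0"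
      unfolding D by simp
  qed
  then show thesis unfolding A_def B_def by (rule that[OF \<theta>(1)])
qed

section \<open>Circle families on a surface\<close>

text \<open>Every normalization of the circles (restricting the interval, reversing them, rotating each
  one by an angle \<open>\<theta>(s)\<close>) is of this form.  Smoothness of the new immersion is read off from the
  explicit formula for \<open>F \<circ> p\<close>, whose dependence on \<open>t\<close> is through \<open>e\<^sup>i\<^sup>t\<close> only.\<close>

lemma annular_parametrization_reparam:
  fixes \<sigma> :: real
  assumes p: "annular_parametrization M F I p"
    and J: "open_interval J" "J \<subseteq> I"
    and uv: "smooth_on I u" "smooth_on I v"
    and F: "\<And>s t. s \<in> I \<Longrightarrow> F (p (s, t)) = circle_family u v (s, t)"
    and \<theta>: "smooth_on J \<theta>" and \<sigma>: "\<sigma> = 1 \<or> \<sigma> = - 1"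
  shows "annular_parametrization M F J (\<lambda>z. p (fst z, \<sigma> * snd z + \<theta> (fst z)))"
proof -
  define g where "g z = \<sigma> * snd z + \<theta> (fst z)" for z
  define \<phi> where "\<phi> z = (fst z, g z)" for z
  have \<sigma>\<sigma>: "\<sigma> * \<sigma> = 1" using \<sigma> by auto
  have oJ: "open J" using J(1) by (simp add: open_interval_def)
  have opJ: "open (J \<times> (UNIV :: real set))" using oJ by (simp add: open_Times)
  from p have oI: "open I" and par: "parametrization M F (I \<times> UNIV) p"
    and period: "\<And>s s' t t'. s \<in> I \<Longrightarrow> s' \<in> I \<Longrightarrow>
        p (s, t) = p (s', t') \<longleftrightarrow> s = s' \<and> (\<exists>k::int. t' = t + 2 * pi * of_int k)"
    unfolding annular_parametrization_def open_interval_def by blast+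
  from par have pc: "continuous_map (top_of_set (I \<times> UNIV)) M p"
    and po: "open_map (top_of_set (I \<times> UNIV)) M p"
    and pi: "immersion_on (I \<times> UNIV) (F \<circ> p)"
    unfolding parametrization_def by blast+
  have img: "\<phi> z \<in> I \<times> UNIV" if "z \<in> J \<times> UNIV" for z
    using that J(2) by (auto simp: \<phi>_def)
  have sg: "smooth_on (J \<times> UNIV) g"
  proof -
    have "smooth_on (J \<times> UNIV) (\<lambda>z :: real \<times> real. \<theta> (fst z))"
      using smooth_on_compose[OF opJ oJ _ \<theta> smooth_on_linear[OF opJ bounded_linear_fst smooth_on_id[OF opJ]]]
      by auto
    then show ?thesis
      unfolding g_def[abs_def]
      by (intro smooth_on_add[OF opJ] smooth_on_linear[OF opJ _ smooth_on_id[OF opJ], of "\<lambda>z. \<sigma> * snd z"]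
          bounded_linear_const_mult bounded_linear_snd)
  qed
  have c\<theta>: "continuous_on (J \<times> (UNIV :: real set)) (\<lambda>z. \<theta> (fst z))"
    by (rule continuous_on_compose2[OF smooth_on_continuous[OF \<theta>] continuous_on_fst[OF continuous_on_id]]) auto
  have c\<phi>: "continuous_on (J \<times> UNIV) \<phi>"
    unfolding \<phi>_def[abs_def] g_def by (intro continuous_intros c\<theta>)
  have hom: "homeomorphism (J \<times> UNIV) (J \<times> UNIV) \<phi> (\<lambda>z. (fst z, \<sigma> * (snd z - \<theta> (fst z))))"
  proof (rule homeomorphismI)
    show "continuous_on (J \<times> UNIV) (\<lambda>z. (fst z, \<sigma> * (snd z - \<theta> (fst z))))"
      by (intro continuous_intros c\<theta>)
  qed (use c\<phi> in \<open>auto simp: \<phi>_def g_def algebra_simps \<sigma>\<sigma> mult.assoc[symmetric]\<close>)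
  have "parametrization M F (J \<times> UNIV) (p \<circ> \<phi>)"
    unfolding parametrization_def
  proof (intro conjI)
    show "open (J \<times> (UNIV :: real set))" by (rule opJ)
    show "continuous_map (top_of_set (J \<times> UNIV)) M (p \<circ> \<phi>)"
      by (rule continuous_map_compose[OF _ pc]) (use c\<phi> img in \<open>auto simp: continuous_map_in_subtopology\<close>)
    show "open_map (top_of_set (J \<times> UNIV)) M (p \<circ> \<phi>)"
    proof (rule open_map_compose[OF _ po])
      show "open_map (top_of_set (J \<times> UNIV)) (top_of_set (I \<times> UNIV)) \<phi>"
        unfolding open_map_def
      proof (intro allI impI)
        fix W :: "(real \<times> real) set" assume "openin (top_of_set (J \<times> UNIV)) W"
        then have "openin (top_of_set (J \<times> UNIV)) (\<phi> ` W)"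
          by (rule homeomorphism_imp_open_map[OF hom])
        then show "openin (top_of_set (I \<times> UNIV)) (\<phi> ` W)"
          using opJ oI J(2) by (auto simp: openin_open_eq open_Times)
      qed
    qed
    show "immersion_on (J \<times> UNIV) (F \<circ> (p \<circ> \<phi>))"
      unfolding immersion_on_def
    proof (intro conjI ballI)
      have "(F \<circ> (p \<circ> \<phi>)) z = circle_family u v (fst z, g z)" if "z \<in> J \<times> UNIV" for z
        using that J(2) F by (auto simp: \<phi>_def)
      moreover have "smooth_on (J \<times> UNIV) (\<lambda>z. circle_family u v (fst z, g z))"
        by (rule smooth_on_circle_family_reparam[OF oJ smooth_on_subset[OF uv(1) J(2)]
              smooth_on_subset[OF uv(2) J(2)] sg])
      ultimately show "smooth_on (J \<times> UNIV) (F \<circ> (p \<circ> \<phi>))"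
        by (subst smooth_on_cong[OF opJ])
      fix z :: "real \<times> real" assume z: "z \<in> J \<times> UNIV"
      define d where "d = vector_derivative \<theta> (at (fst z))"
      have "(\<theta> has_vector_derivative d) (at (fst z))"
        unfolding d_def using z by (intro smooth_on_vector_derivative[OF \<theta> oJ]) auto
      then have "((\<lambda>z. \<theta> (fst z)) has_derivative (\<lambda>h. fst h *\<^sub>R d)) (at z)"
        unfolding has_vector_derivative_def
        by (intro has_derivative_compose[of fst fst _ UNIV \<theta> "\<lambda>x. x *\<^sub>R d"])
          (auto intro!: derivative_eq_intros)
      then have D\<phi>: "(\<phi> has_derivative (\<lambda>h. (fst h, \<sigma> * snd h + fst h *\<^sub>R d))) (at z)"
        unfolding \<phi>_def[abs_def] g_def by (auto intro!: derivative_eq_intros)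
      let ?D = "frechet_derivative (F \<circ> p) (at (\<phi> z))"
      have "(F \<circ> p has_derivative ?D) (at (\<phi> z))"
        by (rule smooth_on_has_derivative[OF _ img[OF z]]) (use pi in \<open>simp add: immersion_on_def\<close>)
      from has_derivative_compose[OF D\<phi> this]
      have "(F \<circ> (p \<circ> \<phi>) has_derivative (\<lambda>h. ?D (fst h, \<sigma> * snd h + fst h *\<^sub>R d))) (at z)"
        by (simp add: o_def)
      then have eq: "frechet_derivative (F \<circ> (p \<circ> \<phi>)) (at z) = ?D \<circ> (\<lambda>h. (fst h, \<sigma> * snd h + fst h *\<^sub>R d))"
        by (simp add: frechet_derivative_at[symmetric] o_def)
      have "inj ?D" 
        by (rule bspec[OF conjunct2[OF pi[unfolded immersion_on_def]] img[OF z]])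
      moreover have "inj (\<lambda>h. (fst h, \<sigma> * snd h + fst h *\<^sub>R d))"
        using \<sigma> by (auto simp: inj_def)
      ultimately show "inj (frechet_derivative (F \<circ> (p \<circ> \<phi>)) (at z))"
        unfolding eq by (rule inj_compose)
    qed
  qed
  moreover have "p (\<phi> (s, t)) = p (\<phi> (s', t')) \<longleftrightarrow> s = s' \<and> (\<exists>k::int. t' = t + 2 * pi * of_int k)"
    if "s \<in> J" "s' \<in> J" for s s' t t'
  proof -
    have "(\<exists>k::int. \<sigma> * t' + x = \<sigma> * t + x + 2 * pi * of_int k) \<longleftrightarrow>
        (\<exists>k::int. t' = t + 2 * pi * of_int k)" (is "?L \<longleftrightarrow> ?R") for x
      using \<sigma>
    proof
      assume "\<sigma> = - 1"
      then show ?thesis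
        by (safe; rule_tac x = "- k" in exI) (simp_all add: algebra_simps)
    qed (simp add: algebra_simps)
    then have shift: "s = s' \<and> (\<exists>k::int. \<sigma> * t' + \<theta> s' = \<sigma> * t + \<theta> s + 2 * pi * of_int k) \<longleftrightarrow>
        s = s' \<and> (\<exists>k::int. t' = t + 2 * pi * of_int k)"
      by auto
    have "s \<in> I" "s' \<in> I" using that J(2) by auto
    from period[OF this] show ?thesis
      by (simp add: \<phi>_def g_def shift)
  qed
  ultimately show ?thesis
    using J(1) by (auto simp: annular_parametrization_def \<phi>_def g_def o_def)
qed

text \<open>The local situation: a Lagrangian annulus of circles in terms of its Fourier coefficients.  It is
  preserved by exchanging \<open>u\<close> and \<open>v\<close> while reversing the circles.\<close>

locale lagrangian_circles =
  fixes M :: "'m topology" and F :: "'m \<Rightarrow> complex ^ 2"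
    and I :: "real set" and p :: "real \<times> real \<Rightarrow> 'm" and u v :: "real \<Rightarrow> complex ^ 2"
  assumes annular: "annular_parametrization M F I p"
    and lagr: "lagrangian M F"
    and smooth_u: "smooth_on I u" and smooth_v: "smooth_on I v"
    and orthogonal: "s \<in> I \<Longrightarrow> herm (u s) (v s) = 0"
    and nonzero: "s \<in> I \<Longrightarrow> u s \<noteq> 0 \<or> v s \<noteq> 0"
    and F_eq: "s \<in> I \<Longrightarrow> F (p (s, t)) = circle_family u v (s, t)"
begin

abbreviation du where "du s \<equiv> vector_derivative u (at s)"
abbreviation dv where "dv s \<equiv> vector_derivative v (at s)"

lemma interval: "open_interval I" and open_I: "open I"
  using annular by (auto simp: annular_parametrization_def open_interval_def)

lemmas du = smooth_on_vector_derivative[OF smooth_u open_I]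
lemmas dv = smooth_on_vector_derivative[OF smooth_v open_I]

lemma parametrization: "parametrization M F (I \<times> UNIV) p"
  using annular by (simp add: annular_parametrization_def)

lemma frechet_derivative_eq:
  assumes "s \<in> I"
  shows "frechet_derivative (F \<circ> p) (at (s, t)) = (\<lambda>h.
      fst h *\<^sub>R (cis t *s du s + cis (- t) *s dv s) +
      snd h *\<^sub>R (\<i> *s (cis t *s u s - cis (- t) *s v s)))"
proof -
  have op: "open (I \<times> (UNIV :: real set))" using open_I by (simp add: open_Times)
  have "(F \<circ> p has_derivative (\<lambda>h.
      fst h *\<^sub>R (cis t *s du s + cis (- t) *s dv s) +
      snd h *\<^sub>R (\<i> *s (cis t *s u s - cis (- t) *s v s)))) (at (s, t))"
    by (rule has_derivative_transform_within_open[OF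
          circle_family_has_derivative[OF du(1)[OF assms] dv(1)[OF assms]] op])
      (use assms F_eq in auto)
  then show ?thesis by (rule frechet_derivative_at[symmetric])
qed

text \<open>The frequency \<open>2\<close> part of the Lagrangian condition identifies \<open>\<langle>u', v\<rangle>\<close> with \<open>\<langle>u, v'\<rangle>\<close>; their
  sum is the derivative of \<open>\<langle>u, v\<rangle> = 0\<close>, so each of them vanishes.\<close>

lemma
  assumes "s \<in> I"
  shows balanced: "Re (herm (du s) (u s)) = Re (herm (dv s) (v s))"
    and du_orthogonal: "herm (du s) (v s) = 0"
    and dv_orthogonal: "herm (dv s) (u s) = 0"
proof -
  have "(cis t *s du s + cis (- t) *s dv s) \<bullet> (\<i> *s (\<i> *s (cis t *s u s - cis (- t) *s v s))) = 0" for t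
  proof -
    have "continuous_map (top_of_set (I \<times> UNIV)) M p"
      using parametrization by (simp add: parametrization_def)
    then have "p (s, t) \<in> topspace M"
      using assms by (auto dest!: continuous_map_image_subset_topspace)
    moreover have "frechet_derivative (F \<circ> p) (at (s, t)) h \<in> tangent_vectors M F (p (s, t))" for h
      unfolding tangent_vectors_def using parametrization assms by blast
    ultimately have "frechet_derivative (F \<circ> p) (at (s, t)) (1, 0)
        \<bullet> (\<i> *s frechet_derivative (F \<circ> p) (at (s, t)) (0, 1)) = 0"
      using lagr unfolding lagrangian_def by blast
    then show ?thesis unfolding frechet_derivative_eq[OF assms] by simp
  qed
  note L = lagrangian_circle_family_herm[OF this]
  from L(1) show "Re (herm (du s) (u s)) = Re (herm (dv s) (v s))" .
  have "((\<lambda>s. herm (u s) (v s)) has_vector_derivative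
      (herm (u s) (dv s) + herm (du s) (v s))) (at s)"
    by (rule bounded_bilinear.has_vector_derivative[OF bounded_bilinear_herm du(1)[OF assms] dv(1)[OF assms]])
  moreover have "((\<lambda>s. herm (u s) (v s)) has_vector_derivative 0) (at s)"
    by (rule has_vector_derivative_transform_within_open[OF has_vector_derivative_const open_I assms])
      (simp add: orthogonal)
  ultimately have "herm (u s) (dv s) + herm (du s) (v s) = 0"
    using vector_derivative_at by metis
  with L(2) herm_commute[of "u s" "dv s"] show "herm (du s) (v s) = 0" by simp
  with L(2) show "herm (dv s) (u s) = 0" by simp
qed

text \<open>Where \<open>u\<close> and \<open>u'\<close> vanish, dependence of \<open>v'\<close> on \<open>v\<close> would make \<open>v'\<close> a real multiple of
  \<open>i v\<close>, because \<open>\<bar>v\<bar>\<close> is stationary there; then \<open>X\<^sub>s\<close> and \<open>X\<^sub>t\<close> would be parallel.\<close>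

lemma immersed:
  assumes "s \<in> I" "u s = 0" "du s = 0"
  shows "cdet (v s) (dv s) \<noteq> 0"
proof
  assume "cdet (v s) (dv s) = 0"
  moreover have "v s \<noteq> 0" using nonzero assms by blast
  ultimately have dv_eq: "dv s = (herm (dv s) (v s) / complex_of_real ((norm (v s))\<^sup>2)) *s v s"
    by (rule cdet_eq_0_imp_smult)
  define m where "m = Im (herm (dv s) (v s)) / (norm (v s))\<^sup>2"
  have "herm (dv s) (v s) / complex_of_real ((norm (v s))\<^sup>2) = \<i> * of_real m"
    using balanced[OF assms(1)] assms by (simp add: m_def complex_eq_iff herm_def Re_divide_of_real Im_divide_of_real)
  with dv_eq have "dv s = (\<i> * of_real m) *s v s" by simp
  then have "frechet_derivative (F \<circ> p) (at (s, 0)) (1, m) = frechet_derivative (F \<circ> p) (at (s, 0)) (0, 0)"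
    unfolding frechet_derivative_eq[OF assms(1)] using assms
    by (simp add: vec_eq_iff forall_2 scaleR_conv_of_real[where 'a = complex])
  moreover have "inj (frechet_derivative (F \<circ> p) (at (s, 0)))"
    using parametrization assms(1) by (auto simp: parametrization_def immersion_on_def)
  ultimately show False by (auto dest: injD)
qed

lemma norm_difference_constant:
  obtains k where "\<And>s. s \<in> I \<Longrightarrow> (norm (u s))\<^sup>2 - (norm (v s))\<^sup>2 = k"
proof -
  have sq: "((\<lambda>s. w s \<bullet> w s) has_vector_derivative (2 * Re (herm w' (w s)))) (at s)"
    if "(w has_vector_derivative w') (at s)" for s w' and w :: "real \<Rightarrow> complex ^ 2"
    using bounded_bilinear.has_vector_derivative[OF bounded_bilinear_inner that that]
    by (simp add: inner_commute[of "w s"] inner_herm[symmetric])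
  have "((\<lambda>s. u s \<bullet> u s - v s \<bullet> v s) has_vector_derivative 0) (at s)" if "s \<in> I" for s
    using has_vector_derivative_diff[OF sq[OF du(1)[OF that]] sq[OF dv(1)[OF that]]] balanced[OF that]
    by simp
  then obtain k where "\<And>s. s \<in> I \<Longrightarrow> u s \<bullet> u s - v s \<bullet> v s = k"
    using constant_if_vector_derivative_0[OF interval] by blast
  then show thesis
    by (intro that[of k]) (simp add: power2_norm_eq_inner)
qed

lemma reparam:
  assumes "open_interval J" "J \<subseteq> I" "smooth_on J \<theta>" "\<sigma> = 1 \<or> \<sigma> = - 1"
  shows "annular_parametrization M F J (\<lambda>z. p (fst z, \<sigma> * snd z + \<theta> (fst z)))"
  by (rule annular_parametrization_reparam[OF annular assms(1,2) smooth_u smooth_v F_eq assms(3,4)])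

lemma reversed: "lagrangian_circles M F I (\<lambda>z. p (fst z, - snd z)) v u"
proof
  show "annular_parametrization M F I (\<lambda>z. p (fst z, - snd z))"
    using reparam[OF interval subset_refl smooth_on_const[OF open_I, of 0], of "- 1"] by simp
  show "herm (v s) (u s) = 0" if "s \<in> I" for s
    using orthogonal[OF that] herm_commute[of "v s" "u s"] by simp
  show "F (p (fst (s, t), - snd (s, t))) = circle_family v u (s, t)" if "s \<in> I" for s t
    by (simp add: F_eq[OF that] circle_family_def add.commute)
  show "v s \<noteq> 0 \<or> u s \<noteq> 0" if "s \<in> I" for s
    using nonzero[OF that] by blast
qed (rule lagr smooth_u smooth_v)+

end

section \<open>The three normal forms\<close>

text \<open>Congruence to one of the three types near \<open>q\<close>; it is the common target of all branches of the
  case distinction.\<close>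

definition standard_at :: "'m topology \<Rightarrow> ('m \<Rightarrow> complex ^ 2) \<Rightarrow> 'm \<Rightarrow> bool" where
  "standard_at M F q \<longleftrightarrow> (\<exists>U\<in>U2. \<exists>I p X.
     annular_parametrization M F I p \<and> q \<in> p ` (I \<times> UNIV) \<and>
     (\<forall>s\<in>I. \<forall>t. F (p (s, t)) = U *v X s t) \<and>
     (complex_extensor I X \<or> hopf_type I X \<or> de_Sitter_type I X))"

lemma norm_smult: "norm (c *s w) = cmod c * norm w"
  for c :: complex and w :: "complex ^ 2"
proof -
  have "complex_of_real ((norm (c *s w))\<^sup>2) = (c * cnj c) * herm w w"
    by (simp only: herm_self[symmetric] herm_smult_left herm_smult_right mult_ac)
  also have "\<dots> = complex_of_real ((cmod c * norm w)\<^sup>2)"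
    by (simp only: herm_self complex_norm_square[symmetric] power_mult_distrib of_real_mult of_real_power)
  finally have "(norm (c *s w))\<^sup>2 = (cmod c * norm w)\<^sup>2"
    by (simp only: of_real_eq_iff)
  then show ?thesis by (simp add: power2_eq_iff_nonneg)
qed

lemma eventually_neq_if_derivative_neq_0:
  fixes f :: "real \<Rightarrow> 'a::real_normed_vector"
  assumes "(f has_vector_derivative d) (at x)" "d \<noteq> 0"
  shows "eventually (\<lambda>y. f y \<noteq> f x) (at x)"
proof -
  have "norm d / 2 > 0" using assms(2) by simp
  with assms(1) obtain e where e: "e > 0"
    "\<And>y. norm (y - x) < e \<Longrightarrow> norm (f y - f x - (y - x) *\<^sub>R d) \<le> norm d / 2 * norm (y - x)"
    unfolding has_vector_derivative_def has_derivative_at_alt by blast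
  have "f y \<noteq> f x" if "y \<noteq> x" "dist y x < e" for y
  proof
    assume "f y = f x"
    then have "norm (y - x) * norm d \<le> norm d / 2 * norm (y - x)"
      using e(2)[of y] that(2) by (simp add: dist_norm)
    moreover have "norm (y - x) * norm d > 0" using that(1) assms(2) by simp
    ultimately show False by (simp add: field_simps)
  qed
  then show ?thesis unfolding eventually_at using e(1) by blast
qed

context lagrangian_circles
begin

lemma circle_family_rotate:
  "circle_family u v (s, t + \<theta>) = (cis t * cis \<theta>) *s u s + (cis (- t) * cis (- \<theta>)) *s v s"
  by (simp add: circle_family_def cis_mult)

lemma mem_reparam_image:
  assumes "s \<in> J" "\<sigma> = 1 \<or> \<sigma> = - 1"
  shows "p (s, t) \<in> (\<lambda>z. p (fst z, \<sigma> * snd z + \<theta> (fst z))) ` (J \<times> UNIV)"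
proof (rule image_eqI)
  have "\<sigma> * \<sigma> = 1" using assms(2) by auto
  then show "p (s, t) = p (fst (s, \<sigma> * (t - \<theta> s)), \<sigma> * snd (s, \<sigma> * (t - \<theta> s)) + \<theta> (fst (s, \<sigma> * (t - \<theta> s))))"
    by (simp flip: mult.assoc)
qed (use assms in simp)

lemma standard_at_reparamI:
  assumes "open_interval J" "J \<subseteq> I" "s0 \<in> J" "smooth_on J \<theta>" "\<sigma> = 1 \<or> \<sigma> = - 1" "U \<in> U2"
    and "\<And>s t. s \<in> J \<Longrightarrow> F (p (s, \<sigma> * t + \<theta> s)) = U *v X s t"
    and "complex_extensor J X \<or> hopf_type J X \<or> de_Sitter_type J X"
  shows "standard_at M F (p (s0, t0))"
  unfolding standard_at_def
proof (intro bexI[OF _ assms(6)] exI conjI)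
  show "annular_parametrization M F J (\<lambda>z. p (fst z, \<sigma> * snd z + \<theta> (fst z)))"
    by (rule reparam[OF assms(1,2,4,5)])
  show "p (s0, t0) \<in> (\<lambda>z. p (fst z, \<sigma> * snd z + \<theta> (fst z))) ` (J \<times> UNIV)"
    by (rule mem_reparam_image[OF assms(3,5)])
qed (use assms(7,8) in simp_all)

text \<open>Both \<open>v\<close> and \<open>v'\<close> are orthogonal to \<open>u\<close>.\<close>

lemma cdet_eq_0:
  assumes "s \<in> I" "u s \<noteq> 0"
  shows "cdet (v s) (dv s) = 0"
  using assms orthogonal[OF assms(1)] herm_commute[of "v s" "u s"]
  by (intro cdet_herm_eq_0[OF _ dv_orthogonal]) auto

text \<open>With \<open>u = e\<^sup>x e\<^sup>i\<^sup>a u\<^sub>0\<close> and \<open>v = e\<^sup>x e\<^sup>i\<^sup>b v\<^sub>0\<close>, the shift \<open>\<theta> = (b - a)/2\<close> gives both terms the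
  common phase \<open>\<phi> = (a + b)/2\<close>, and \<open>e\<^sup>i\<^sup>t u\<^sub>0 + e\<^sup>-\<^sup>i\<^sup>t v\<^sub>0\<close> is a real circle in the unitary frame
  \<open>(u\<^sub>0 + v\<^sub>0)/\<surd>2\<close>, \<open>i (u\<^sub>0 - v\<^sub>0)/\<surd>2\<close>.  Hence a complex extensor.\<close>

lemma standard_if_equal_norms:
  assumes "\<And>s. s \<in> I \<Longrightarrow> norm (u s) = norm (v s)" and s0: "s0 \<in> I"
  shows "standard_at M F (p (s0, t0))"
proof -
  have nz: "u s \<noteq> 0" "v s \<noteq> 0" if "s \<in> I" for s
    using assms(1)[OF that] nonzero[OF that] by auto
  interpret rev: lagrangian_circles M F I "\<lambda>z. p (fst z, - snd z)" v u by (rule reversed)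
  obtain x a u0 where u0: "smooth_on I x" "smooth_on I a" "norm u0 = 1"
    "\<And>s. s \<in> I \<Longrightarrow> u s = (of_real (exp (x s)) * cis (a s)) *s u0"
    using curve_on_complex_line[OF interval smooth_u nz(1) rev.cdet_eq_0[OF _ nz(2)]] by metis
  obtain y b v0 where v0: "smooth_on I y" "smooth_on I b" "norm v0 = 1"
    "\<And>s. s \<in> I \<Longrightarrow> v s = (of_real (exp (y s)) * cis (b s)) *s v0"
    using curve_on_complex_line[OF interval smooth_v nz(2) cdet_eq_0[OF _ nz(1)]] by metis
  have xy: "exp (y s) = exp (x s)" if "s \<in> I" for s
    using assms(1)[OF that] unfolding u0(4)[OF that] v0(4)[OF that]
    by (simp add: norm_smult norm_mult u0(3) v0(3))
  have "herm u0 v0 = 0"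
    using orthogonal[OF s0] unfolding u0(4)[OF s0] v0(4)[OF s0] by (simp add: herm_simps)
  then have h: "herm u0 v0 = 0" "herm v0 u0 = 0" "herm u0 u0 = 1" "herm v0 v0 = 1"
    using herm_commute[of v0 u0] u0(3) v0(3) by (simp_all add: herm_self)
  define c where "c = complex_of_real (1 / sqrt 2)"
  have cc: "c * c = 1 / 2" "cnj c = c"
    unfolding c_def by (simp_all flip: of_real_mult)
  have frame: "herm (c *s (u0 + v0)) (c *s (u0 + v0)) = 1"
    "herm ((\<i> * c) *s (u0 - v0)) ((\<i> * c) *s (u0 - v0)) = 1"
    "herm (c *s (u0 + v0)) ((\<i> * c) *s (u0 - v0)) = 0"
    using cc by (simp_all add: herm_simps h algebra_simps)
  obtain U where U: "U \<in> U2"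
    "\<And>x y. U *v vector [x, y] = x *s (c *s (u0 + v0)) + y *s ((\<i> * c) *s (u0 - v0))"
    using unitary_frame[OF frame] by blast
  define \<theta> where "\<theta> s = (1 / 2) * (b s + - a s)" for s
  define \<phi> where "\<phi> s = (1 / 2) * (a s + b s)" for s
  define r where "r s = sqrt 2 * exp (x s)" for s
  note scale = smooth_on_bilinear[OF open_I bounded_bilinear_mult smooth_on_const[OF open_I]]
  have sm: "smooth_on I \<theta>" "smooth_on I \<phi>" "smooth_on I r"
    unfolding \<theta>_def[abs_def] \<phi>_def[abs_def] r_def[abs_def]
    by (rule scale smooth_on_add[OF open_I] smooth_on_uminus[OF open_I] u0 v0
        smooth_on_compose[OF open_I open_UNIV _ smooth_on_exp] subset_UNIV)+
  define X :: "real \<Rightarrow> real \<Rightarrow> complex ^ 2" where "X s t = (complex_of_real (r s) * exp (\<i> * complex_of_real (\<phi> s))) *s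
    vector [complex_of_real (cos t), complex_of_real (sin t)]" for s t
  have "F (p (s, 1 * t + \<theta> s)) = U *v X s t" if "s \<in> I" for s t
  proof -
    have ph: "cis (\<theta> s) * cis (a s) = cis (\<phi> s)" "cis (- \<theta> s) * cis (b s) = cis (\<phi> s)"
      by (simp_all add: cis_mult \<theta>_def \<phi>_def field_simps)
    have "F (p (s, 1 * t + \<theta> s)) =
        (of_real (exp (x s)) * cis t * (cis (\<theta> s) * cis (a s))) *s u0 +
        (of_real (exp (x s)) * cis (- t) * (cis (- \<theta> s) * cis (b s))) *s v0"
      using F_eq[OF that] xy[OF that]
      by (simp add: circle_family_rotate u0(4)[OF that] v0(4)[OF that] vector_smult_assoc mult_ac)
    also have "\<dots> = (of_real (exp (x s)) * cis (\<phi> s)) *s (cis t *s u0 + cis (- t) *s v0)"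
      unfolding ph by (simp add: vec_eq_iff forall_2 algebra_simps)
    also have "cis t *s u0 + cis (- t) *s v0 =
        of_real (cos t) *s (u0 + v0) + of_real (sin t) *s (\<i> *s (u0 - v0))"
      by (simp add: vec_eq_iff forall_2 complex_eq_iff algebra_simps)
    also have "\<dots> = of_real (sqrt 2) *s (U *v vector [complex_of_real (cos t), complex_of_real (sin t)])"
    proof -
      have "of_real (sqrt 2) * c = 1" by (simp add: c_def)
      moreover have "of_real (sqrt 2) *s (U *v vector [x, y]) =
          (of_real (sqrt 2) * c) *s (x *s (u0 + v0) + y *s (\<i> *s (u0 - v0)))" for x y
        unfolding U(2) by (simp add: vec_eq_iff forall_2 algebra_simps)
      ultimately show ?thesis by simp
    qed
    finally show ?thesis
      by (simp add: X_def r_def vector_scalar_commute cis_conv_exp vector_smult_assoc mult_ac)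
  qed
  moreover have "complex_extensor I X"
    unfolding complex_extensor_def X_def
  proof (intro exI conjI)
    show "smooth_on I r" "smooth_on I \<phi>" by (rule sm)+
  qed (simp_all add: r_def)
  ultimately show ?thesis
    using standard_at_reparamI[OF interval subset_refl s0 sm(1) _ U(1), of 1] by blast
qed

text \<open>Only the term \<open>e\<^sup>-\<^sup>i\<^sup>t v\<close> is left, and \<open>v\<close> runs in a sphere: after reversing the circles and a
  phase normalization this is of Hopf type.\<close>

lemma standard_if_u_vanishes:
  assumes J: "open_interval J" "J \<subseteq> I" "s0 \<in> J"
    and u0: "\<And>s. s \<in> J \<Longrightarrow> u s = 0" and c: "c > 0" "\<And>s. s \<in> J \<Longrightarrow> norm (v s) = c"
  shows "standard_at M F (p (s0, t0))"
proof -
  have oJ: "open J" using J(1) by (simp add: open_interval_def)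
  define w where "w s = (1 / c) *\<^sub>R v s" for s
  have "smooth_on J w"
    unfolding w_def[abs_def]
    by (rule smooth_on_linear[OF oJ bounded_linear_scaleR_right smooth_on_subset[OF smooth_v J(2)]])
  moreover have "norm (w s) = 1" if "s \<in> J" for s
    using c by (simp add: w_def that)
  ultimately obtain \<theta> where \<theta>: "smooth_on J \<theta>" "legendrian_S3 J (\<lambda>s. cis (\<theta> s) *s w s)"
    using legendrian_S3_phase[OF J(1)] by blast
  define X where "X s t = (complex_of_real c * exp (\<i> * complex_of_real t)) *s (cis (\<theta> s) *s w s)" for s t
  have "F (p (s, - 1 * t + - \<theta> s)) = mat 1 *v X s t" if "s \<in> J" for s t
  proof -
    have "F (p (s, - t + - \<theta> s)) = (cis t * cis (\<theta> s)) *s v s"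
      using F_eq[of s "- t + - \<theta> s"] that J(2) u0[OF that] unfolding circle_family_rotate by auto
    also have "v s = of_real c *s w s"
      using c by (simp add: w_def vec_eq_iff forall_2 scaleR_conv_of_real[where 'a = complex])
    finally show ?thesis
      by (simp add: X_def cis_conv_exp vector_smult_assoc mult_ac)
  qed
  moreover have "hopf_type J X"
    unfolding hopf_type_def X_def[abs_def] using \<theta>(2) by blast
  moreover have "mat 1 \<in> U2"
    by (simp add: U2_def vec_eq_iff map_matrix_def transpose_def matrix_matrix_mult_def mat_def forall_2 sum_2)
  ultimately show ?thesis
    using standard_at_reparamI[OF J smooth_on_uminus[OF oJ \<theta>(1)], of "- 1"] by blast
qed

text \<open>Here \<open>v\<close> stays on a complex line and hence \<open>u\<close>, which is orthogonal to \<open>v \<noteq> 0\<close>, on the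
  orthogonal line, where it is free to vanish.  The coordinates in an adapted unitary frame,
  divided by \<open>c\<close>, form a curve in the anti-De Sitter space, which a phase makes Legendrian.\<close>

lemma standard_if_v_on_complex_line:
  assumes J: "open_interval J" "J \<subseteq> I" "s0 \<in> J"
    and c: "c > 0" "\<And>s. s \<in> J \<Longrightarrow> (norm (u s))\<^sup>2 - (norm (v s))\<^sup>2 = - c\<^sup>2"
    and det: "\<And>s. s \<in> J \<Longrightarrow> cdet (v s) (dv s) = 0"
  shows "standard_at M F (p (s0, t0))"
proof -
  have oJ: "open J" using J(1) by (simp add: open_interval_def)
  have vnz: "v s \<noteq> 0" if "s \<in> J" for s
    using c(2)[OF that] c(1) by (smt (verit) norm_zero power2_eq_square power2_less_eq_zero_iff zero_le_power2 mult_zero_left zero_less_power2)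
  obtain x y v0 where v0: "norm v0 = 1"
    "\<And>s. s \<in> J \<Longrightarrow> v s = (of_real (exp (x s)) * cis (y s)) *s v0"
    using curve_on_complex_line[OF J(1) smooth_on_subset[OF smooth_v J(2)] vnz det] by metis
  define u0 where "u0 = orth v0"
  have h: "herm v0 v0 = 1" "herm u0 v0 = 0" "herm v0 u0 = 0"
    using v0(1) herm_orth_left[of v0] herm_commute[of v0 u0]
    by (simp_all add: u0_def herm_self)
  then have "herm u0 u0 = 1" by (simp add: u0_def herm_orth_self)
  note h = h this
  obtain U where U: "U \<in> U2" "\<And>x y. U *v vector [x, y] = x *s u0 + y *s v0"
    using unitary_frame[OF h(4,1,2)] by blast
  have dec: "u s = herm (u s) u0 *s u0" "v s = herm (v s) v0 *s v0" if "s \<in> J" for s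
  proof -
    have "herm (u s) v0 = 0"
      using orthogonal[of s] that J(2) unfolding v0(2)[OF that] by (auto simp: herm_simps)
    then show "u s = herm (u s) u0 *s u0"
      using orth_decomposition[OF v0(1), of "u s"] by (simp add: u0_def)
    show "v s = herm (v s) v0 *s v0"
      unfolding v0(2)[OF that] by (simp add: herm_simps h)
  qed
  have sq: "(norm (a *s w))\<^sup>2 = (cmod a)\<^sup>2" if "herm w w = 1" for a w
  proof -
    have "(norm w)\<^sup>2 = 1" using that unfolding herm_self by (simp only: of_real_eq_1_iff)
    then show ?thesis by (simp add: norm_smult power_mult_distrib)
  qed
  define a b where "a s = (1 / c) *\<^sub>R herm (u s) u0" and "b s = (1 / c) *\<^sub>R herm (v s) v0" for s
  have "smooth_on J (\<lambda>s. (1 / c) *\<^sub>R herm (w s) w0)" if "smooth_on I w" for w w0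
    by (rule smooth_on_linear[OF oJ bounded_linear_scaleR_right smooth_on_bilinear[OF oJ bounded_bilinear_herm
            smooth_on_subset[OF that J(2)] smooth_on_const[OF oJ]]])
  then have sab: "smooth_on J a" "smooth_on J b"
    unfolding a_def[abs_def] b_def[abs_def] using smooth_u smooth_v by blast+
  have "(cmod (a s))\<^sup>2 - (cmod (b s))\<^sup>2 = - 1" if "s \<in> J" for s
  proof -
    have "(cmod (herm (u s) u0))\<^sup>2 - (cmod (herm (v s) v0))\<^sup>2 = - c\<^sup>2"
      using c(2)[OF that] dec[OF that] sq h by metis
    then show ?thesis
      using c(1) by (simp add: a_def b_def power_divide field_simps)
  qed
  then obtain \<theta> where \<theta>: "smooth_on J \<theta>"
    "legendrian_AdS J (\<lambda>s. vector [cis (\<theta> s) * a s, cis (- \<theta> s) * b s])"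
    using legendrian_AdS_phase[OF J(1) sab] by blast
  define \<alpha> :: "real \<Rightarrow> complex ^ 2" where "\<alpha> s = vector [cis (\<theta> s) * a s, cis (- \<theta> s) * b s]" for s
  define X where "X s t = complex_of_real c *s
      (vector [\<alpha> s $ 1 * exp (\<i> * complex_of_real t), \<alpha> s $ 2 * exp (- \<i> * complex_of_real t)] :: complex ^ 2)" for s t
  have "F (p (s, 1 * t + \<theta> s)) = U *v X s t" if "s \<in> J" for s t
  proof -
    have e: "exp (\<i> * complex_of_real t) = cis t" "exp (- \<i> * complex_of_real t) = cis (- t)"
      by (simp_all add: cis_conv_exp)
    have ab: "u s = (of_real c * a s) *s u0" "v s = (of_real c * b s) *s v0"
      using dec[OF that] c(1) by (simp_all add: a_def b_def scaleR_conv_of_real[where 'a = complex])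
    have "s \<in> I" using that J(2) by blast
    from F_eq[OF this, of "t + \<theta> s"]
    have "F (p (s, t + \<theta> s)) =
        (cis t * cis (\<theta> s)) *s ((of_real c * a s) *s u0) +
        (cis (- t) * cis (- \<theta> s)) *s ((of_real c * b s) *s v0)"
      unfolding circle_family_rotate ab .
    then show ?thesis
      unfolding X_def \<alpha>_def e vector_scalar_commute U(2)
      by (simp add: vec_eq_iff forall_2 algebra_simps)
  qed
  moreover have "de_Sitter_type J X"
    unfolding de_Sitter_type_def X_def[abs_def] using \<theta>(2) unfolding \<alpha>_def[symmetric] by blast
  ultimately show ?thesis
    using standard_at_reparamI[OF J \<theta>(1) _ U(1), of 1] by blast
qed

lemma eventually_interval:
  assumes "eventually P (nhds s0)" "s0 \<in> I"
  obtains J where "open_interval J" "J \<subseteq> I" "s0 \<in> J" "\<And>s. s \<in> J \<Longrightarrow> P s"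
proof -
  have "eventually (\<lambda>s. P s \<and> s \<in> I) (nhds s0)"
    using assms open_I by (simp add: eventually_conj eventually_nhds_in_open)
  then obtain e where e: "e > 0" "\<And>s. dist s s0 < e \<Longrightarrow> P s \<and> s \<in> I"
    unfolding eventually_nhds_metric by blast
  show thesis
    by (rule that[of "ball s0 e"]) (use e in \<open>auto simp: open_interval_def is_interval_ball_real dist_commute\<close>)
qed

text \<open>The case distinction is made on whether \<open>v\<close> and \<open>v'\<close> are dependent at \<open>s\<^sub>0\<close>, not on
  whether \<open>u(s\<^sub>0)\<close> vanishes: both types contain circles with \<open>u = 0\<close>, and only the behaviour
  of \<open>v\<close> decides which type the neighbouring circles have.\<close>

lemma standard_if_unbalanced:
  assumes k: "\<And>s. s \<in> I \<Longrightarrow> (norm (u s))\<^sup>2 - (norm (v s))\<^sup>2 = k" "k < 0" and s0: "s0 \<in> I"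
  shows "standard_at M F (p (s0, t0))"
proof -
  define c where "c = sqrt (- k)"
  have c: "c > 0" "c\<^sup>2 = - k" using k(2) by (simp_all add: c_def)
  define D where "D s = cdet (v s) (dv s)" for s
  show ?thesis
  proof (cases "D s0 = 0")
    case False
    have "smooth_on I D"
      unfolding D_def by (rule smooth_on_bilinear[OF open_I bounded_bilinear_cdet smooth_v dv(2)])
    from smooth_on_continuous[OF this] have "isCont D s0"
      using s0 open_I by (simp add: continuous_on_eq_continuous_at)
    then have "eventually (\<lambda>s. D s \<noteq> 0) (nhds s0)"
      using tendsto_imp_eventually_ne[OF _ False] by (simp add: isCont_def tendsto_at_iff_tendsto_nhds)
    then obtain J where J: "open_interval J" "J \<subseteq> I" "s0 \<in> J" "\<And>s. s \<in> J \<Longrightarrow> D s \<noteq> 0"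
      using eventually_interval[OF _ s0] by blast
    have u: "u s = 0" if "s \<in> J" for s
      using cdet_eq_0 J(2,4) that unfolding D_def by blast
    have vc: "norm (v s) = c" if "s \<in> J" for s
    proof -
      have "(norm (v s))\<^sup>2 = c\<^sup>2" using k(1)[of s] J(2) that u[OF that] c(2) by auto
      then show ?thesis using c(1) by (simp add: power2_eq_iff_nonneg)
    qed
    show ?thesis by (rule standard_if_u_vanishes[OF J(1-3) u c(1) vc])
  next
    case True
    have "eventually (\<lambda>s. u s \<noteq> 0) (at s0)"
    proof (cases "u s0 = 0")
      case False
      have "isCont u s0"
        using s0 open_I smooth_on_continuous[OF smooth_u] by (simp add: continuous_on_eq_continuous_at)
      then show ?thesis
        using tendsto_imp_eventually_ne[OF _ False] by (simp add: isCont_def)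
    next
      case u0: True
      have "du s0 \<noteq> 0" using immersed[OF s0 u0] True by (auto simp: D_def)
      from eventually_neq_if_derivative_neq_0[OF du(1)[OF s0] this] show ?thesis
        by (simp add: u0)
    qed
    moreover have "eventually (\<lambda>s. s \<in> I) (at s0)"
      using s0 open_I by (simp add: eventually_at_in_open')
    ultimately have "eventually (\<lambda>s. D s = 0) (at s0)"
      by eventually_elim (simp add: D_def cdet_eq_0)
    then have "eventually (\<lambda>s. D s = 0) (nhds s0)"
      using True by (simp add: eventually_nhds_conv_at)
    then obtain J where J: "open_interval J" "J \<subseteq> I" "s0 \<in> J" "\<And>s. s \<in> J \<Longrightarrow> D s = 0"
      using eventually_interval[OF _ s0] by blast
    show ?thesis
      by (rule standard_if_v_on_complex_line[OF J(1-3) c(1)]) (use k J c in \<open>auto simp: D_def\<close>)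
  qed
qed

lemma standard:
  assumes s0: "s0 \<in> I"
  shows "standard_at M F (p (s0, t0))"
proof -
  obtain k where k: "\<And>s. s \<in> I \<Longrightarrow> (norm (u s))\<^sup>2 - (norm (v s))\<^sup>2 = k"
    using norm_difference_constant by blast
  consider "k < 0" | "k = 0" | "k > 0" by linarith
  then show ?thesis
  proof cases
    case 1
    then show ?thesis using standard_if_unbalanced[OF k _ s0] by blast
  next
    case 2
    then have "norm (u s) = norm (v s)" if "s \<in> I" for s
      using k[OF that] by (simp add: power2_eq_iff_nonneg)
    then show ?thesis by (rule standard_if_equal_norms[OF _ s0])
  next
    case 3
    interpret rev: lagrangian_circles M F I "\<lambda>z. p (fst z, - snd z)" v u by (rule reversed)
    have "(norm (v s))\<^sup>2 - (norm (u s))\<^sup>2 = - k" if "s \<in> I" for s using k[OF that] by simp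
    from rev.standard_if_unbalanced[OF this _ s0, of "- t0"] 3 show ?thesis by simp
  qed
qed

end

theorem theorem1:
  fixes M :: "'m topology" and F :: "'m \<Rightarrow> complex ^ 2"
  assumes "centered_cyclic_surface M F"
    and "lagrangian M F"
  shows "\<forall>q\<in>topspace M. \<exists>U\<in>U2. \<exists>I p X.
           annular_parametrization M F I p \<and> q \<in> p ` (I \<times> UNIV) \<and>
           (\<forall>s\<in>I. \<forall>t. F (p (s, t)) = U *v X s t) \<and>
           (complex_extensor I X \<or> hopf_type I X \<or> de_Sitter_type I X)"
proof
  fix q assume "q \<in> topspace M"
  then obtain I p where p: "annular_parametrization M F I p" "q \<in> p ` (I \<times> UNIV)"
    and circ: "centered_circles I (\<lambda>s t. F (p (s, t)))"
    using assms(1) unfolding centered_cyclic_surface_def by blast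
  have "open I" using p(1) by (simp add: annular_parametrization_def open_interval_def)
  from centered_circles_Fourier[OF circ this] obtain u v where uv: "smooth_on I u" "smooth_on I v"
    "\<And>s. s \<in> I \<Longrightarrow> herm (u s) (v s) = 0" "\<And>s. s \<in> I \<Longrightarrow> u s \<noteq> 0 \<or> v s \<noteq> 0"
    "\<And>s t. s \<in> I \<Longrightarrow> F (p (s, t)) = circle_family u v (s, t)" by metis
  interpret lagrangian_circles M F I p u v
    by unfold_locales (rule p(1) assms(2) uv; assumption?)+
  from p(2) obtain s0 t0 where "s0 \<in> I" "q = p (s0, t0)" by auto
  with standard show "\<exists>U\<in>U2. \<exists>I p X.
           annular_parametrization M F I p \<and> q \<in> p ` (I \<times> UNIV) \<and>
           (\<forall>s\<in>I. \<forall>t. F (p (s, t)) = U *v X s t) \<and>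
           (complex_extensor I X \<or> hopf_type I X \<or> de_Sitter_type I X)"
    unfolding standard_at_def by blast
qed

end
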